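(* Let $n\ge 1$ and let $\mathbf{G}_n=\{(x_1,\dots,x_n):0\le x_1\le 2,\ 0\le x_i\le 2x_{i-1}\ (2\le i\le n)\}$. For a labeled forest $F$ on $\{1,\dots,n+1\}$ define, for each label $k$, the coordinate $c(k,F)$: if the node with label $k$ is the root of its component and has NFS position $l$, then $c(k,F)=x_l$ (with $x_0:=1$); otherwise $c(k,F)=x_i/2^{j}-x_l$, where $i$ is the NFS position of the node, $j$ the number of cane paths in $F$ starting at it, and $l$ the NFS position of the root of its component. Let $$\mathbf{S}_F=\{(x_1,\dots,x_n):\ 0\le c(1,F)\le c(2,F)\le\dots\le c(n+1,F)=1\}.$$ Then $\mathbf{S}_F$ is a simplex and $$n!\operatorname{vol}\mathbf{S}_F=\bigl|\{G\text{ labeled graph on }\{1,\dots,n+1\}:\Phi(G)=F\}\bigr|=2^{\alpha(F)}.$$ Furthermore, the simplices $\mathbf{S}_F$, $F$ ranging over labeled forests on $\{1,\dots,n+1\}$, form a triangulation of $\mathbf{G}_n$; in particular $n!\operatorname{vol}\mathbf{G}_n=2^{\binom{n+1}{2}}$.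
   Context: Labeled forest conventions: each component of a labeled forest on $\{1,\dots,n+1\}$ is rooted at its node of largest label, children of each node are ordered left to right by increasing label, components are ordered left to right by decreasing largest label. NFS positions in a forest on $n+1$ nodes: each node gets a position in $\{0,\dots,n\}$. Components are processed from left to right; when a component is begun its root gets the next unused position (so the root of the leftmost component, which is node $n+1$, gets $0$, and each root gets the number of nodes in the components to its left). Within a component the root is initially active; the children of the active node receive the next consecutive positions from right to left, and then the leftmost of these children becomes active; if the active node has no children, the most recently positioned node that has not yet been active becomes active. Cane paths: a path $v_0,\dots,v_k$ ($k\ge 2$) in the rooted forest such that each of the first $k-1$ steps goes from a node to its parent and the last step goes from $v_{k-1}$ to a child of $v_{k-1}$ lying to the right of (i.e. with larger label than) $v_{k-2}$. $\alpha(F)$ is the total number of cane paths in $F$. Neighbors-first search (NFS) of a labeled graph $G$ on $\{1,\dots,n+1\}$: components are processed in order of decreasing maximal label; in a component, its node of maximal label is visited first and made active; at each step the unvisited neighbours of the active node are visited in decreasing order of label, each joined to the active node by a search edge, and the one of smallest label becomes active; if the active node has no unvisited neighbours, the most recently visited node not yet active becomes active. $\Phi(G)$ is the labeled spanning forest of search edges. A triangulation of a polytope $P\subset\mathbb{R}^n$ is a set of $n$-simplices whose union is $P$ and whose interiors are pairwise disjoint. *)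

theory Defs
  imports "HOL-Analysis.Analysis"
begin

section \<open>Labeled graphs and labeled forests on \<open>{1..n+1}\<close>\<close>

text \<open>A labeled graph is identified with its set of edges, an edge being a two-element set of nodes.\<close>

definition labeled_graphs :: "nat \<Rightarrow> nat set set set" where
  "labeled_graphs n = {E. E \<subseteq> {e. e \<subseteq> {1..n+1} \<and> card e = 2}}"

definition graph_path :: "nat set set \<Rightarrow> nat list \<Rightarrow> bool" where
  "graph_path E vs \<longleftrightarrow> vs \<noteq> [] \<and> distinct vs \<and> successively (\<lambda>u v. {u, v} \<in> E) vs"

definition graph_cycle :: "nat set set \<Rightarrow> nat list \<Rightarrow> bool" where
  "graph_cycle E vs \<longleftrightarrow> length vs \<ge> 3 \<and> graph_path E vs \<and> {last vs, hd vs} \<in> E"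

definition labeled_forests :: "nat \<Rightarrow> nat set set set" where
  "labeled_forests n = {F \<in> labeled_graphs n. \<nexists>vs. graph_cycle F vs}"

definition graph_component :: "nat set set \<Rightarrow> nat \<Rightarrow> nat set" where
  "graph_component E v = {w. (v, w) \<in> {(a, b). {a, b} \<in> E}\<^sup>*}"

definition comp_root :: "nat set set \<Rightarrow> nat \<Rightarrow> nat" where
  "comp_root E v = Max (graph_component E v)"

definition comp_roots :: "nat \<Rightarrow> nat set set \<Rightarrow> nat set" where
  "comp_roots n E = comp_root E ` {1..n+1}"

text \<open>In a rooted forest, the parent of \<open>v\<close> is the node following \<open>v\<close> on the path from \<open>v\<close> to
  the root of its component.\<close>

definition is_parent :: "nat set set \<Rightarrow> nat \<Rightarrow> nat \<Rightarrow> bool" where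
  "is_parent F p v \<longleftrightarrow> (\<exists>vs. graph_path F (v # p # vs) \<and> last (p # vs) = comp_root F v)"

definition children :: "nat set set \<Rightarrow> nat \<Rightarrow> nat set" where
  "children F p = {v. is_parent F p v}"


section \<open>Neighbors-first search\<close>

text \<open>A state \<open>(vis, act, T)\<close> consists of the nodes visited so far in the order of their visits, the
  nodes that have been made active so far in the order of their activations (so that \<open>last act\<close> is
  the active node), and the set of search edges. The parameter \<open>R\<close> is the set of maximal labels of
  the components, and \<open>new A a\<close> is the set of nodes to be visited from the active node \<open>a\<close> when \<open>A\<close>
  is the set of visited nodes. A step visits these nodes in decreasing order of label and then
  determines the next active node, starting the next component if the current one is finished.\<close>

definition nfs_step ::
  "nat set \<Rightarrow> (nat set \<Rightarrow> nat \<Rightarrow> nat set) \<Rightarrow>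
    nat list \<times> nat list \<times> nat set set \<Rightarrow> nat list \<times> nat list \<times> nat set set" where
  "nfs_step R new = (\<lambda>(vis, act, T).
     let a = last act;
         N = new (set vis) a;
         vis' = vis @ rev (sorted_list_of_set N);
         T' = T \<union> {{a, u} | u. u \<in> N};
         waiting = filter (\<lambda>v. v \<notin> set act) vis';
         R' = R - set vis'
     in if N \<noteq> {} then (vis', act @ [Min N], T')
        else if waiting \<noteq> [] then (vis', act @ [last waiting], T')
        else if R' \<noteq> {} then (vis' @ [Max R'], act @ [Max R'], T')
        else (vis', act, T'))"

text \<open>The search starts at the node \<open>n+1\<close>, the maximal label of the first component. Every step
  processes one active node, so \<open>n+1\<close> steps complete the search.\<close>

definition nfs_run ::
  "nat \<Rightarrow> nat set \<Rightarrow> (nat set \<Rightarrow> nat \<Rightarrow> nat set) \<Rightarrow> nat list \<times> nat list \<times> nat set set" where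
  "nfs_run n R new = (nfs_step R new ^^ (n+1)) ([n+1], [n+1], {})"

definition nfs_forest :: "nat \<Rightarrow> nat set set \<Rightarrow> nat set set" (\<open>\<Phi>\<close>) where
  "\<Phi> n G = snd (snd (nfs_run n (comp_roots n G) (\<lambda>A a. {u. {a, u} \<in> G} - A)))"

definition nfs_order :: "nat \<Rightarrow> nat set set \<Rightarrow> nat list" where
  "nfs_order n F = fst (nfs_run n (comp_roots n F) (\<lambda>A a. children F a))"

text \<open>Positions are consecutive and start with 0, so the position of a node is the number of nodes
  positioned before it.\<close>

definition nfs_pos :: "nat \<Rightarrow> nat set set \<Rightarrow> nat \<Rightarrow> nat" where
  "nfs_pos n F v = length (takeWhile (\<lambda>u. u \<noteq> v) (nfs_order n F))"


section \<open>Cane paths\<close>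

text \<open>The list \<open>[v\<^sub>0, \<dots>, v\<^sub>k]\<close> has length \<open>k + 1\<close>.\<close>

definition cane_path :: "nat set set \<Rightarrow> nat list \<Rightarrow> bool" where
  "cane_path F vs \<longleftrightarrow> (\<exists>k\<ge>2. length vs = k + 1 \<and>
     (\<forall>i<k-1. is_parent F (vs ! (i+1)) (vs ! i)) \<and>
     vs ! k \<in> children F (vs ! (k-1)) \<and> vs ! k > vs ! (k-2))"

definition cane_number :: "nat set set \<Rightarrow> nat" (\<open>\<alpha>\<close>) where
  "\<alpha> F = card {vs. cane_path F vs}"

definition canes_from :: "nat set set \<Rightarrow> nat \<Rightarrow> nat" where
  "canes_from F v = card {vs. cane_path F vs \<and> hd vs = v}"


section \<open>The Gayley polytope and the simplices\<close>

text \<open>The space of real \<open>n\<close>-tuples is \<open>real ^ 'n\<close> with a numbering \<open>\<iota>\<close> of the index type by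
  \<open>1, \<dots>, n\<close>. The coordinate with number 0 is the constant 1.\<close>

definition coord :: "(nat \<Rightarrow> 'n) \<Rightarrow> real ^ 'n \<Rightarrow> nat \<Rightarrow> real" where
  "coord \<iota> x i = (if i = 0 then 1 else x $ \<iota> i)"

definition gayley_polytope :: "nat \<Rightarrow> (nat \<Rightarrow> 'n) \<Rightarrow> (real ^ 'n) set" where
  "gayley_polytope n \<iota> = {x. 0 \<le> coord \<iota> x 1 \<and> coord \<iota> x 1 \<le> 2 \<and>
     (\<forall>i\<in>{2..n}. 0 \<le> coord \<iota> x i \<and> coord \<iota> x i \<le> 2 * coord \<iota> x (i-1))}"

definition node_coord ::
  "nat \<Rightarrow> (nat \<Rightarrow> 'n) \<Rightarrow> nat set set \<Rightarrow> real ^ 'n \<Rightarrow> nat \<Rightarrow> real" where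
  "node_coord n \<iota> F x k =
    (let l = nfs_pos n F (comp_root F k)
     in if k = comp_root F k then coord \<iota> x l
        else coord \<iota> x (nfs_pos n F k) / 2 ^ canes_from F k - coord \<iota> x l)"

definition forest_simplex :: "nat \<Rightarrow> (nat \<Rightarrow> 'n) \<Rightarrow> nat set set \<Rightarrow> (real ^ 'n) set" where
  "forest_simplex n \<iota> F = {x. 0 \<le> node_coord n \<iota> F x 1 \<and>
     (\<forall>k\<in>{1..n}. node_coord n \<iota> F x k \<le> node_coord n \<iota> F x (k+1)) \<and>
     node_coord n \<iota> F x (n+1) = 1}"

text \<open>Simplices need not meet in common faces here; the library constant \<^const>\<open>triangulation\<close>
  is stronger in this respect.\<close>

definition triangulates :: "'a::euclidean_space set set \<Rightarrow> 'a set \<Rightarrow> bool" where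
  "triangulates \<T> P \<longleftrightarrow> polytope P \<and> (\<forall>S\<in>\<T>. int DIM('a) simplex S) \<and> \<Union>\<T> = P \<and>
     pairwise (\<lambda>S T. interior S \<inter> interior T = {}) \<T>"

end

theory Submission
  imports Defs
begin

text \<open>
  Neighbors-first search is a stack machine: the nodes that are visited but not yet active form a
  stack, and the number of cane paths from a node is the height at which it sits in that stack. An
  edge of \<open>G\<close> that is not a search edge joins a node, when it becomes active, to a node waiting in
  the stack, and such edges do not influence the search. So the graphs with \<open>\<Phi> G = F\<close> arise from
  \<open>F\<close> by adding an arbitrary set of these cane edges, of which there are \<open>\<alpha> F\<close>.

  In the order of the positions, the coordinates of \<open>S\<^sub>F\<close> are a triangular affine image of
  \<open>x\<close> with diagonal entries \<open>2\<^sup>-\<^sup>h\<close>, where \<open>h\<close> is the stack height, so \<open>S\<^sub>F\<close> is the preimage of an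
  order simplex, of volume \<open>2\<^sup>\<alpha>/n!\<close>. The Gayley polytope itself is such a preimage, since its
  inequalities say that \<open>x\<^sub>i / 2\<^sup>i\<close> decreases. A point in the interior of \<open>S\<^sub>F\<close> determines \<open>F\<close>: the
  roots are the strict left-to-right minima of \<open>x\<close>, the height of a node at position \<open>q\<close> in the
  component of a root at position \<open>l\<close> is the integer part of \<open>log\<^sub>2 (x\<^sub>q / x\<^sub>l)\<close>, and then the values
  of the coordinates determine the labels. Hence the simplices do not overlap; as they lie in the
  polytope and their volumes sum to the number of all graphs divided by \<open>n!\<close>, which is the volume
  of the polytope, they cover it.
\<close>

section \<open>Components and paths of graphs\<close>

lemma filter_neq_last: "distinct xs \<Longrightarrow> xs \<noteq> [] \<Longrightarrow> filter (\<lambda>x. x \<noteq> last xs) xs = butlast xs"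
  by (induction xs rule: rev_induct) (auto simp: filter_id_conv)

lemma sym_adjacency: "sym {(a, b). {a, b} \<in> E}"
  by (auto simp: sym_def insert_commute)

lemma self_in_graph_component [simp]: "v \<in> graph_component E v"
  by (simp add: graph_component_def)

lemma graph_component_eq:
  assumes "w \<in> graph_component E v"
  shows "graph_component E w = graph_component E v"
proof -
  let ?R = "{(a, b). {a, b} \<in> E}"
  have "(v, w) \<in> ?R\<^sup>*" using assms by (simp add: graph_component_def)
  moreover have "(w, v) \<in> ?R\<^sup>*"
    using calculation sym_rtrancl[OF sym_adjacency] by (rule symD[rotated])
  ultimately show ?thesis
    unfolding graph_component_def by (blast intro: rtrancl_trans)
qed

lemma comp_root_eq: "w \<in> graph_component E v \<Longrightarrow> comp_root E w = comp_root E v"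
  by (simp add: comp_root_def graph_component_eq)

lemma comp_root_adjacent:
  assumes "{v, w} \<in> E" shows "comp_root E w = comp_root E v"
  using assms by (intro comp_root_eq) (auto simp: graph_component_def)

lemma graph_component_closed:
  assumes "v \<in> C" and "\<And>a b. a \<in> C \<Longrightarrow> {a, b} \<in> E \<Longrightarrow> b \<in> C"
  shows "graph_component E v \<subseteq> C"
proof
  fix w assume "w \<in> graph_component E v"
  then have "(v, w) \<in> {(a, b). {a, b} \<in> E}\<^sup>*" by (simp add: graph_component_def)
  then show "w \<in> C" by induction (use assms in auto)
qed

lemma exists_graph_path:
  assumes "(u, v) \<in> {(a, b). {a, b} \<in> E}\<^sup>*"
  shows "\<exists>vs. graph_path E vs \<and> hd vs = u \<and> last vs = v"
  using assms
proof (induction rule: converse_rtrancl_induct)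
  case base
  have "graph_path E [v]" by (simp add: graph_path_def)
  then show ?case by force
next
  case (step u y)
  then obtain vs where vs: "graph_path E vs" "hd vs = y" "last vs = v" by blast
  show ?case
  proof (cases "u \<in> set vs")
    case True
    \<comment> \<open>If the new node already lies on the path, the path is cut at its occurrence,
      which keeps the list distinct.\<close>
    then obtain xs ys where "vs = xs @ u # ys" by (auto simp: in_set_conv_decomp)
    with vs have "graph_path E (u # ys)" "last (u # ys) = v"
      by (auto simp: graph_path_def successively_append_iff)
    then show ?thesis by force
  next
    case False
    with vs step.hyps have "graph_path E (u # vs)" "last (u # vs) = v"
      by (auto simp: graph_path_def successively_Cons)
    then show ?thesis by force
  qed
qed

lemma labeled_graph_edgeD:
  assumes "E \<in> labeled_graphs n" "{a, b} \<in> E"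
  shows "a \<in> {1..n+1}" "b \<in> {1..n+1}" "a \<noteq> b"
  using assms by (auto simp: labeled_graphs_def card_2_iff doubleton_eq_iff subset_iff)

lemma labeled_graph_edgeE:
  assumes "E \<in> labeled_graphs n" "e \<in> E"
  obtains a b where "e = {a, b}" "a \<in> {1..n+1}" "b \<in> {1..n+1}" "a \<noteq> b"
proof -
  have "e \<subseteq> {1..n+1}" "card e = 2" using assms by (auto simp: labeled_graphs_def)
  then show ?thesis using that by (metis card_2_iff insert_subset)
qed

lemma graph_component_subset_nodes:
  assumes "E \<in> labeled_graphs n" "v \<in> {1..n+1}"
  shows "graph_component E v \<subseteq> {1..n+1}"
  using assms labeled_graph_edgeD(2)[OF assms(1)] by (intro graph_component_closed) auto

lemma comp_root_in_component:
  assumes "E \<in> labeled_graphs n" "v \<in> {1..n+1}"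
  shows "comp_root E v \<in> graph_component E v"
  unfolding comp_root_def
proof (rule Max_in)
  show "finite (graph_component E v)"
    using graph_component_subset_nodes[OF assms] by (rule finite_subset) simp
  show "graph_component E v \<noteq> {}" using self_in_graph_component by blast
qed

lemma le_comp_root:
  assumes "E \<in> labeled_graphs n" "v \<in> {1..n+1}"
  shows "v \<le> comp_root E v"
  unfolding comp_root_def
proof (rule Max_ge)
  show "finite (graph_component E v)"
    using graph_component_subset_nodes[OF assms] by (rule finite_subset) simp
qed simp

lemma comp_roots_subset_nodes:
  assumes "E \<in> labeled_graphs n"
  shows "comp_roots n E \<subseteq> {1..n+1}"
  using comp_root_in_component[OF assms] graph_component_subset_nodes[OF assms]
  unfolding comp_roots_def by blast

text \<open>Hence a search may look for its next root among all unvisited nodes.\<close>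

lemma comp_root_Max_unvisited:
  assumes E: "E \<in> labeled_graphs n"
    and closed: "\<And>a b. a \<in> C \<Longrightarrow> {a, b} \<in> E \<Longrightarrow> b \<in> C"
    and ne: "{1..n+1} - C \<noteq> {}"
  shows "comp_root E (Max ({1..n+1} - C)) = Max ({1..n+1} - C)"
proof -
  let ?m = "Max ({1..n+1} - C)"
  have m: "?m \<in> {1..n+1} - C" using ne by (intro Max_in) auto
  have "graph_component E ?m \<subseteq> {1..n+1} - C"
  proof (rule graph_component_closed[OF m])
    fix a b assume "a \<in> {1..n+1} - C" "{a, b} \<in> E"
    then show "b \<in> {1..n+1} - C"
      using closed[of b a] labeled_graph_edgeD[OF E] by (auto simp: insert_commute)
  qed
  then have "comp_root E ?m \<in> {1..n+1} - C"
    using comp_root_in_component[OF E, of ?m] m by blast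
  then have "comp_root E ?m \<le> ?m" by (intro Max_ge) auto
  then show ?thesis using le_comp_root[OF E, of ?m] m by force
qed

lemma Max_unvisited_comp_roots:
  assumes E: "E \<in> labeled_graphs n"
    and closed: "\<And>a b. a \<in> C \<Longrightarrow> {a, b} \<in> E \<Longrightarrow> b \<in> C"
  shows "comp_roots n E - C = {} \<longleftrightarrow> {1..n+1} - C = {}"
    and "comp_roots n E - C \<noteq> {} \<Longrightarrow> Max (comp_roots n E - C) = Max ({1..n+1} - C)"
proof -
  let ?m = "Max ({1..n+1} - C)"
  have sub: "comp_roots n E - C \<subseteq> {1..n+1} - C"
    using comp_roots_subset_nodes[OF E] by blast
  have m: "?m \<in> comp_roots n E - C" if "{1..n+1} - C \<noteq> {}"
  proof -
    have "?m \<in> {1..n+1} - C" using that by (intro Max_in) auto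
    moreover have "comp_root E ?m = ?m" using E closed that by (rule comp_root_Max_unvisited)
    ultimately show ?thesis unfolding comp_roots_def by (metis DiffE DiffI image_eqI)
  qed
  show *: "comp_roots n E - C = {} \<longleftrightarrow> {1..n+1} - C = {}" using sub m by blast
  assume "comp_roots n E - C \<noteq> {}"
  then show "Max (comp_roots n E - C) = ?m"
    using m sub * by (intro Max_eqI) (auto intro: finite_subset[OF sub] Max_ge)
qed

section \<open>Neighbors-first search\<close>

locale labeled_graph =
  fixes n :: nat and G :: "nat set set"
  assumes graph: "G \<in> labeled_graphs n"
begin

abbreviation "nodes \<equiv> {1..n+1}"

definition "nbrs v = {u. {v, u} \<in> G}"

text \<open>The root set is all of \<open>nodes\<close> and not \<open>comp_roots n G\<close>, so
  the run depends on \<open>G\<close> only through the unvisited neighbours of the active node, and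
  runs on different graphs can be compared. \<open>nfs_run_eq_state\<close> shows that the outcome
  is the same.\<close>

definition "state t = (nfs_step nodes (\<lambda>A a. nbrs a - A) ^^ t) ([n+1], [n+1], {})"
definition "visited t = fst (state t)"
definition "activated t = fst (snd (state t))"
definition "search_edges t = snd (snd (state t))"
definition "active t = last (activated t)"
definition "fresh t = nbrs (active t) - set (visited t)"
definition "pushed t = rev (sorted_list_of_set (fresh t))"
definition "waiting t = filter (\<lambda>v. v \<notin> set (activated t)) (visited t)"
text \<open>The stack after the push of step \<open>t\<close> and before its pop, with the top at
  the end of the list. Nodes are pushed in decreasing order, so the top is the smallest fresh
  neighbour if there is one and otherwise the most recently visited node that waits: the first two
  rules of the search are a single pop.\<close>

definition "stack t = waiting t @ pushed t"

section \<open>Single steps of the search and their invariant\<close>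

lemma nbrs_subset: "nbrs v \<subseteq> nodes"
  using labeled_graph_edgeD[OF graph] by (auto simp: nbrs_def)

lemma fresh_subset: "fresh t \<subseteq> nodes"
  using nbrs_subset by (auto simp: fresh_def)

lemma finite_fresh [simp]: "finite (fresh t)"
  using fresh_subset finite_subset by blast

lemma set_pushed [simp]: "set (pushed t) = fresh t"
  by (simp add: pushed_def)

lemma pushed_eq_Nil [simp]: "pushed t = [] \<longleftrightarrow> fresh t = {}"
  by (simp add: pushed_def)

lemma distinct_pushed [simp]: "distinct (pushed t)"
  by (simp add: pushed_def)

lemma last_pushed: "fresh t \<noteq> {} \<Longrightarrow> last (pushed t) = Min (fresh t)"
  by (simp add: pushed_def last_rev Min.in_idem sorted_list_of_set_nonempty)

lemma stack_eq_Nil: "stack t = [] \<longleftrightarrow> waiting t = [] \<and> fresh t = {}"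
  by (simp add: stack_def)

text \<open>The last clause says that a node is left only after all its neighbours have been
  visited. When the stack is empty, it makes the visited set closed under adjacency, that is, a
  union of components.\<close>

definition "search_invar t \<longleftrightarrow>
  distinct (visited t) \<and> set (visited t) \<subseteq> nodes \<and>
  distinct (activated t) \<and> set (activated t) \<subseteq> set (visited t) \<and>
  length (activated t) = Suc t \<and>
  (\<forall>u \<in> set (activated t) - {active t}. nbrs u \<subseteq> set (visited t))"

lemma state_step:
  "state (Suc t) =
    (if stack t \<noteq> [] then (visited t @ pushed t, activated t @ [last (stack t)],
        search_edges t \<union> {{active t, u} |u. u \<in> fresh t})
     else if nodes - set (visited t) \<noteq> {} then
        (visited t @ [Max (nodes - set (visited t))], activated t @ [Max (nodes - set (visited t))],
          search_edges t)
     else (visited t, activated t, search_edges t))" (is "_ = ?rhs")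
  if "set (activated t) \<subseteq> set (visited t)"
proof -
  \<comment> \<open>Fresh nodes are unvisited and hence not activated, so the filter of
    \<open>nfs_step\<close> keeps all of them.\<close>
  have w: "filter (\<lambda>v. v \<notin> set (activated t)) (visited t @ pushed t) = stack t"
    using that by (auto simp: stack_def waiting_def fresh_def filter_id_conv)
  have "state (Suc t) = nfs_step nodes (\<lambda>A a. nbrs a - A) (visited t, activated t, search_edges t)"
    by (simp add: state_def visited_def activated_def search_edges_def)
  also have "\<dots> = ?rhs"
    unfolding nfs_step_def split Let_def
    unfolding active_def[symmetric] fresh_def[symmetric] pushed_def[symmetric] w
    by (cases "fresh t = {}") (auto simp: stack_def last_pushed)
  finally show ?thesis .
qed

lemma state_0 [simp]:
  "visited 0 = [n+1]" "activated 0 = [n+1]" "active 0 = n+1" "search_edges 0 = {}" "waiting 0 = []"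
  by (auto simp: visited_def activated_def active_def search_edges_def state_def waiting_def)

lemma search_invar_0: "search_invar 0"
  by (simp add: search_invar_def)

lemma visited_closed:
  assumes "search_invar t" "stack t = []"
  shows "a \<in> set (visited t) \<Longrightarrow> {a, b} \<in> G \<Longrightarrow> b \<in> set (visited t)"
proof -
  assume a: "a \<in> set (visited t)" and ab: "{a, b} \<in> G"
  have "waiting t = []" "fresh t = {}" using assms stack_eq_Nil by auto
  then have "a \<in> set (activated t)" using a by (auto simp: waiting_def filter_empty_conv)
  then show ?thesis
    using assms(1) \<open>fresh t = {}\<close> ab
    by (cases "a = active t") (auto simp: search_invar_def fresh_def nbrs_def)
qed

text \<open>With an empty stack every visited node has been activated, and only \<open>t + 1\<close>
  of the \<open>n + 1\<close> nodes have been activated so far.\<close>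

lemma unvisited_nonempty:
  assumes "search_invar t" "t < n" "stack t = []"
  shows "nodes - set (visited t) \<noteq> {}"
proof -
  have "set (visited t) = set (activated t)"
    using assms stack_eq_Nil[of t] by (auto simp: search_invar_def waiting_def filter_empty_conv)
  then have "card (set (visited t)) = Suc t"
    using assms(1) distinct_card[of "activated t"] by (simp add: search_invar_def)
  then have "card (set (visited t)) < card nodes" using assms(2) by simp
  then show ?thesis
    by (metis Diff_eq_empty_iff List.finite_set card_mono leD)
qed

lemma step_stack:
  assumes "search_invar t" "stack t \<noteq> []"
  shows "visited (Suc t) = visited t @ pushed t"
    and "activated (Suc t) = activated t @ [last (stack t)]"
    and "active (Suc t) = last (stack t)"
    and "search_edges (Suc t) = search_edges t \<union> {{active t, u} |u. u \<in> fresh t}"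
  using assms state_step[of t]
  by (auto simp: search_invar_def visited_def activated_def search_edges_def active_def)

text \<open>\<open>fresh t\<close> is empty here, so the edge clause adds nothing; it has the form
  of the clause in \<open>step_stack\<close> so that \<open>search_edges_eq\<close> can treat both
  kinds of step alike.\<close>

lemma step_root:
  assumes "search_invar t" "stack t = []" "t < n"
  shows "visited (Suc t) = visited t @ [Max (nodes - set (visited t))]"
    and "activated (Suc t) = activated t @ [Max (nodes - set (visited t))]"
    and "active (Suc t) = Max (nodes - set (visited t))"
    and "search_edges (Suc t) = search_edges t \<union> {{active t, u} |u. u \<in> fresh t}"
  using assms state_step[of t] unvisited_nonempty[OF assms(1,3,2)] stack_eq_Nil[of t]
  by (auto simp: search_invar_def visited_def activated_def search_edges_def active_def)

lemma distinct_stack: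
  assumes "search_invar t"
  shows "distinct (stack t)" and "set (stack t) \<inter> set (activated t) = {}"
    and "set (stack t) \<subseteq> set (visited t) \<union> fresh t"
  using assms by (auto simp: search_invar_def stack_def waiting_def fresh_def)

lemma search_invar_Suc:
  assumes inv: "search_invar t" and "t < n"
  shows "search_invar (Suc t)"
proof -
  \<comment> \<open>Both kinds of step append a list \<open>l\<close> of unvisited nodes and
    activate one node \<open>m\<close> that is visited by then but has not been active.\<close>
  obtain l m where step: "visited (Suc t) = visited t @ l" "activated (Suc t) = activated t @ [m]"
    "active (Suc t) = m"
    and l: "distinct l" "set l \<subseteq> nodes - set (visited t)"
    and m: "m \<in> set (visited t) \<union> set l" "m \<notin> set (activated t)"
    and fresh: "fresh t \<subseteq> set l"
  proof (cases "stack t = []")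
    case False
    have "last (stack t) \<in> set (stack t)" using False by simp
    then show ?thesis
      using that[OF step_stack(1-3)[OF inv False]] distinct_stack[OF inv] fresh_subset[of t]
      by (auto simp: fresh_def)
  next
    case True
    have "Max (nodes - set (visited t)) \<in> nodes - set (visited t)"
      using unvisited_nonempty[OF inv assms(2) True] by (intro Max_in) auto
    then show ?thesis
      using that[OF step_root(1-3)[OF inv True assms(2)]] inv True
      by (auto simp: search_invar_def stack_eq_Nil)
  qed
  have "nbrs (active t) \<subseteq> set (visited t) \<union> fresh t" by (auto simp: fresh_def)
  then have nb: "nbrs u \<subseteq> set (visited t) \<union> set l" if "u \<in> set (activated t)" for u
    using that inv fresh unfolding search_invar_def by (cases "u = active t") blast+
  have "set (visited t) \<inter> set l = {}" using l by blast
  note inv' = inv[unfolded search_invar_def]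
  show ?thesis
    unfolding search_invar_def step
  proof (intro conjI ballI)
    show "distinct (visited t @ l)" using inv' l \<open>set (visited t) \<inter> set l = {}\<close> by simp
    show "set (visited t @ l) \<subseteq> nodes" using inv' l by auto
    show "distinct (activated t @ [m])" "length (activated t @ [m]) = Suc (Suc t)"
      using inv' m by simp_all
    show "set (activated t @ [m]) \<subseteq> set (visited t @ l)" using inv' m by auto
    show "nbrs u \<subseteq> set (visited t @ l)" if "u \<in> set (activated t @ [m]) - {m}" for u
      using nb[of u] that by auto
  qed
qed

lemma search_invar: "t \<le> n \<Longrightarrow> search_invar t"
proof (induction t)
  case 0
  show ?case by (rule search_invar_0)
next
  case (Suc t)
  then show ?case by (intro search_invar_Suc) auto
qed

lemma visited_Suc:
  assumes "t < n"
  shows "visited (Suc t) = visited t @ (if stack t = [] then [active (Suc t)] else pushed t)"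
  using step_stack[of t] step_root[of t] search_invar[of t] assms by auto

lemma activated_Suc: "t < n \<Longrightarrow> activated (Suc t) = activated t @ [active (Suc t)]"
  using step_stack[of t] step_root[of t] search_invar[of t] by (cases "stack t = []") auto

lemma active_Suc: "t < n \<Longrightarrow> stack t \<noteq> [] \<Longrightarrow> active (Suc t) = last (stack t)"
  using step_stack[of t] search_invar[of t] by auto

lemma active_Suc_root:
  "t < n \<Longrightarrow> stack t = [] \<Longrightarrow> active (Suc t) = Max (nodes - set (visited t))"
  using step_root[of t] search_invar[of t] by auto

lemma active_Suc_root_unvisited:
  "t < n \<Longrightarrow> stack t = [] \<Longrightarrow> active (Suc t) \<in> nodes - set (visited t)"
  using active_Suc_root[of t] unvisited_nonempty[of t] search_invar[of t]
    Max_in[of "nodes - set (visited t)"] by auto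

lemma waiting_Suc:
  assumes t: "t < n"
  shows "waiting (Suc t) = butlast (stack t)"
proof (cases "stack t = []")
  case True
  then show ?thesis
    using t True stack_eq_Nil[of t]
    by (simp add: waiting_def visited_Suc activated_Suc filter_empty_conv)
next
  case False
  have inv: "search_invar t" using t by (intro search_invar) simp
  have w: "filter (\<lambda>v. v \<notin> set (activated t)) (visited t @ pushed t) = stack t"
    using inv by (auto simp: stack_def waiting_def fresh_def filter_id_conv search_invar_def)
  have "waiting (Suc t) = filter (\<lambda>v. v \<noteq> last (stack t))
      (filter (\<lambda>v. v \<notin> set (activated t)) (visited t @ pushed t))"
    using t False
    by (simp add: waiting_def visited_Suc activated_Suc active_Suc del: filter_append)
      (metis (no_types, lifting))
  also have "\<dots> = butlast (stack t)"
    unfolding w using distinct_stack(1)[OF inv] False by (rule filter_neq_last)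
  finally show ?thesis .
qed

text \<open>For the inductions over time: the nodes waiting at time \<open>t + 1\<close>, with the
  active node on top, are the stack left by the push of step \<open>t\<close>.\<close>

lemma stack_snoc: "t < n \<Longrightarrow> stack t \<noteq> [] \<Longrightarrow> waiting (Suc t) @ [active (Suc t)] = stack t"
  by (simp add: waiting_Suc active_Suc)

lemma waiting_Suc_root: "t < n \<Longrightarrow> stack t = [] \<Longrightarrow> waiting (Suc t) = []"
  by (simp add: waiting_Suc)

section \<open>Times of activation as names of the nodes\<close>

lemma activated_eq: "t \<le> n \<Longrightarrow> activated t = map active [0..<Suc t]"
  by (induction t) (auto simp: activated_Suc)

lemma inj_on_active: "inj_on active {..n}"
proof -
  have "distinct (map active [0..<Suc n])"
    using search_invar[of n] activated_eq[of n] by (simp add: search_invar_def)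
  then show ?thesis
    by (simp only: distinct_map set_upt atLeast0_lessThan_Suc lessThan_Suc_atMost atLeast0LessThan)
qed

lemma active_eq_iff: "s \<le> n \<Longrightarrow> t \<le> n \<Longrightarrow> active s = active t \<longleftrightarrow> s = t"
  using inj_on_active by (auto simp: inj_on_def)

lemma set_activated: "t \<le> n \<Longrightarrow> set (activated t) = active ` {..t}"
  by (simp only: activated_eq set_map set_upt atLeast0LessThan lessThan_Suc_atMost)

lemma set_visited: "t \<le> n \<Longrightarrow> set (visited t) = active ` {..t} \<union> set (waiting t)"
  using search_invar[of t] set_activated[of t] by (auto simp: search_invar_def waiting_def)

lemma waiting_disjoint: "s \<le> t \<Longrightarrow> t \<le> n \<Longrightarrow> active s \<notin> set (waiting t)"
  using set_activated[of t] by (auto simp: waiting_def)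

lemma visited_subset: "t \<le> n \<Longrightarrow> set (visited t) \<subseteq> nodes"
  using search_invar[of t] by (simp add: search_invar_def)

lemma distinct_visited: "t \<le> n \<Longrightarrow> distinct (visited t)"
  using search_invar[of t] by (simp add: search_invar_def)

lemma active_visited: "s \<le> t \<Longrightarrow> t \<le> n \<Longrightarrow> active s \<in> set (visited t)"
  by (simp add: set_visited)

lemma active_in_nodes: "t \<le> n \<Longrightarrow> active t \<in> nodes"
  using active_visited[of t t] visited_subset[of t] by blast

text \<open>There are \<open>n + 1\<close> distinct activations among \<open>n + 1\<close> nodes. So
  the search reaches every node, and a node may be replaced by the unique time at which it is
  active.\<close>

lemma active_image: "active ` {..n} = nodes"
proof (rule card_subset_eq)
  show "active ` {..n} \<subseteq> nodes" using active_in_nodes by blast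
  show "card (active ` {..n}) = card nodes" by (simp add: card_image inj_on_active)
qed simp

lemma node_active:
  assumes "v \<in> nodes" obtains t where "t \<le> n" "v = active t"
  using assms active_image by blast

lemma set_visited_n: "set (visited n) = nodes"
  using set_visited[of n] visited_subset[of n] active_image by blast

lemma waiting_n: "waiting n = []"
  using set_visited_n active_image set_activated[of n] by (simp add: waiting_def filter_empty_conv)

lemma fresh_n: "fresh n = {}"
  using nbrs_subset by (auto simp: fresh_def set_visited_n)

lemma length_visited_n: "length (visited n) = Suc n"
  using distinct_card[OF distinct_visited[of n]] set_visited_n by simp

lemma visited_prefix:
  assumes "s \<le> t" "t \<le> n"
  shows "\<exists>l. visited t = visited s @ l"
  using assms
proof (induction t rule: dec_induct)
  case (step t)
  then obtain l where "visited t = visited s @ l" by auto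
  with step.prems show ?case by (simp add: visited_Suc)
qed simp

lemma visited_mono: "s \<le> t \<Longrightarrow> t \<le> n \<Longrightarrow> set (visited s) \<subseteq> set (visited t)"
  using visited_prefix[of s t] by auto

lemma fresh_unvisited: "u \<in> fresh t \<Longrightarrow> u \<notin> set (visited t)"
  by (simp add: fresh_def)

lemma fresh_visited:
  assumes "u \<in> fresh s" "s < t" "t \<le> n" shows "u \<in> set (visited t)"
proof -
  have "stack s \<noteq> []" using assms by (auto simp: stack_eq_Nil)
  then have "u \<in> set (visited (Suc s))" using assms by (simp add: visited_Suc)
  then show ?thesis using visited_mono[of "Suc s" t] assms by auto
qed

lemma fresh_active:
  assumes "u \<in> fresh s" "s \<le> n" obtains t where "s < t" "t \<le> n" "u = active t"
proof -
  obtain t where t: "t \<le> n" "u = active t"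
    using node_active fresh_subset assms(1) by blast
  have "s < t" using fresh_unvisited[OF assms(1)] active_visited[of t s] t assms(2) by force
  then show ?thesis using that t by blast
qed

lemma waiting_active:
  assumes "u \<in> set (waiting s)" "s \<le> n" obtains t where "s < t" "t \<le> n" "u = active t"
proof -
  have "u \<in> nodes" using assms visited_subset[of s] by (auto simp: waiting_def)
  then obtain t where t: "t \<le> n" "u = active t" by (rule node_active)
  have "s < t" using waiting_disjoint[of t s] assms t by force
  then show ?thesis using that t by blast
qed

text \<open>A fresh node is visited from the next step on and never fresh again; this makes parents
  unique.\<close>

lemma fresh_disjoint: "u \<in> fresh s \<Longrightarrow> u \<in> fresh t \<Longrightarrow> s \<le> n \<Longrightarrow> t \<le> n \<Longrightarrow> s = t"
  using fresh_visited[of u s t] fresh_visited[of u t s] fresh_unvisited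
  by (metis linorder_neqE_nat)

text \<open>The root of the component in progress: a new component begins exactly when the stack
  runs empty.\<close>

primrec current_root where
  "current_root 0 = n + 1"
| "current_root (Suc t) = (if stack t = [] then active (Suc t) else current_root t)"

lemma current_root_active: "\<exists>s\<le>t. current_root t = active s \<and> current_root s = active s"
proof (induction t)
  case (Suc t)
  then show ?case by (cases "stack t = []") (auto intro: exI[of _ "Suc t"] le_SucI)
qed simp

lemma current_root_visited: "t \<le> n \<Longrightarrow> current_root t \<in> set (visited t)"
  using current_root_active[of t] active_visited[of _ t] by metis

lemma visited_cases:
  assumes "v \<in> set (visited t)" "t \<le> n"
  shows "(\<exists>s<t. v \<in> fresh s) \<or> (\<exists>s\<le>t. v = active s \<and> current_root s = v)"
  using assms
proof (induction t)
  case (Suc t)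
  then consider "v \<in> set (visited t)" | "stack t = []" "v = active (Suc t)" | "v \<in> fresh t"
    by (auto simp: visited_Suc split: if_splits)
  then show ?case
  proof cases
    case 1
    then show ?thesis using Suc.IH Suc.prems by (meson le_SucI less_SucI Suc_leD)
  next
    case 2
    then show ?thesis by (intro disjI2 exI[of _ "Suc t"]) simp
  qed blast
qed simp

lemma active_cases:
  assumes "t \<le> n"
  shows "active t = current_root t \<or> (\<exists>s<t. active t \<in> fresh s)"
  using visited_cases[OF active_visited[OF le_refl assms] assms] active_eq_iff assms
  by (metis order_trans)

section \<open>Forest edges and cane edges\<close>

definition "forest_edges = {{active t, u} |t u. t \<le> n \<and> u \<in> fresh t}"
text \<open>When the first end of such a pair becomes active, the other end is already visited, so
  the pair has no influence on the search, whether or not it belongs to \<open>G\<close>. Counted by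
  their active ends, these pairs give the sum of the stack heights.\<close>

definition "cane_edges = {{active t, u} |t u. t \<le> n \<and> u \<in> set (waiting t)}"

lemma forest_edgeI: "t \<le> n \<Longrightarrow> u \<in> fresh t \<Longrightarrow> {active t, u} \<in> forest_edges"
  by (auto simp: forest_edges_def)

lemma cane_edgeI: "t \<le> n \<Longrightarrow> u \<in> set (waiting t) \<Longrightarrow> {active t, u} \<in> cane_edges"
  by (auto simp: cane_edges_def)

lemma search_edges_eq: "t \<le> n \<Longrightarrow> search_edges t = {{active s, u} |s u. s < t \<and> u \<in> fresh s}"
proof (induction t)
  case (Suc t)
  then have "search_edges (Suc t) = search_edges t \<union> {{active t, u} |u. u \<in> fresh t}"
    using step_stack(4)[of t] step_root(4)[of t] search_invar[of t] by (cases "stack t = []") auto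
  then show ?case using Suc by (auto simp: less_Suc_eq)
qed simp

lemma state_Suc_n: "state (Suc n) = (visited n, activated n, forest_edges)"
proof -
  have "t \<le> n \<and> u \<in> fresh t \<longleftrightarrow> t < n \<and> u \<in> fresh t" for t u
    using fresh_n by (metis empty_iff le_neq_implies_less less_imp_le)
  then have "forest_edges = search_edges n"
    by (simp add: search_edges_eq forest_edges_def)
  then show ?thesis
    using state_step[of n] set_visited_n waiting_n fresh_n search_invar[of n]
    by (auto simp: search_invar_def stack_eq_Nil)
qed

lemma forest_edges_subset: "forest_edges \<subseteq> G"
  by (auto simp: forest_edges_def fresh_def nbrs_def)

lemma forest_edges_labeled: "forest_edges \<in> labeled_graphs n"
  using forest_edges_subset graph by (auto simp: labeled_graphs_def)

lemma cane_edges_labeled: "cane_edges \<in> labeled_graphs n"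
proof -
  have "e \<subseteq> nodes \<and> card e = 2" if "e \<in> cane_edges" for e
  proof -
    obtain t u where e: "e = {active t, u}" "t \<le> n" "u \<in> set (waiting t)"
      using \<open>e \<in> cane_edges\<close> by (auto simp: cane_edges_def)
    then obtain s where "t < s" "s \<le> n" "u = active s" using waiting_active by blast
    then show ?thesis using e active_in_nodes[of s] active_in_nodes[of t] active_eq_iff[of s t]
      by simp
  qed
  then show ?thesis by (auto simp: labeled_graphs_def)
qed

text \<open>If \<open>u\<close> were the end from which the edge was found, it would be active later
  than \<open>active t\<close>, and \<open>active t\<close> could not be fresh then.\<close>

lemma forest_edge_unvisited:
  assumes "{active t, u} \<in> forest_edges" "t \<le> n" "u \<notin> set (visited t)"
  shows "u \<in> fresh t"
proof -
  obtain s v where e: "{active t, u} = {active s, v}" "s \<le> n" "v \<in> fresh s"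
    using assms by (auto simp: forest_edges_def)
  show ?thesis
  proof (cases "active t = active s")
    case True
    then show ?thesis using e assms active_eq_iff by (auto simp: doubleton_eq_iff)
  next
    case False
    then have u: "v = active t" "u = active s" using e by (auto simp: doubleton_eq_iff)
    then have "t < s" using assms active_visited[of s t] by force
    then show ?thesis using u e active_visited[of t s] fresh_unvisited by auto
  qed
qed

text \<open>Together with \<open>forest_edge_unvisited\<close>: in a graph made of forest edges and
  cane edges, only forest edges lead from the active node to unvisited nodes.\<close>

lemma cane_edge_visited:
  assumes "{active t, u} \<in> cane_edges" "t \<le> n"
  shows "u \<in> set (visited t)"
proof -
  obtain s v where e: "{active t, u} = {active s, v}" "s \<le> n" "v \<in> set (waiting s)"
    using assms by (auto simp: cane_edges_def)
  show ?thesis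
  proof (cases "active t = active s")
    case True
    then show ?thesis using e assms active_eq_iff by (auto simp: doubleton_eq_iff waiting_def)
  next
    case False
    then have u: "v = active t" "u = active s" using e by (auto simp: doubleton_eq_iff)
    have "\<not> t \<le> s" using waiting_disjoint[of t s] e u by auto
    then show ?thesis using u assms active_visited[of s t] by simp
  qed
qed

lemma forest_cane_disjoint: "forest_edges \<inter> cane_edges = {}"
proof -
  have False if e: "e \<in> forest_edges" "e \<in> cane_edges" for e
  proof -
    obtain t u where "e = {active t, u}" "t \<le> n" "u \<in> fresh t"
      using e(1) by (auto simp: forest_edges_def)
    then show False using cane_edge_visited[of t u] fresh_unvisited e(2) by simp
  qed
  then show ?thesis by blast
qed

lemma graph_subset: "G \<subseteq> forest_edges \<union> cane_edges"
proof
  \<comment> \<open>At the time \<open>s\<close> of the earlier end, the later end has not been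
    active. If it is visited it waits on the stack, otherwise it is fresh.\<close>
  have *: "{active s, active t} \<in> forest_edges \<union> cane_edges"
    if "{active s, active t} \<in> G" "s < t" "t \<le> n" for s t
  proof (cases "active t \<in> set (visited s)")
    case True
    then have "active t \<in> set (waiting s)"
      using that active_eq_iff by (auto simp: set_visited)
    then show ?thesis using cane_edgeI[of s] that by simp
  next
    case False
    then have "active t \<in> fresh s" using that by (auto simp: fresh_def nbrs_def)
    then show ?thesis using forest_edgeI[of s] that by simp
  qed
  fix e assume e: "e \<in> G"
  then obtain a b where ab: "e = {a, b}" "a \<in> nodes" "b \<in> nodes" "a \<noteq> b"
    by (rule labeled_graph_edgeE[OF graph])
  then obtain s t where st: "a = active s" "b = active t" "s \<le> n" "t \<le> n" "s \<noteq> t"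
    by (metis node_active)
  then show "e \<in> forest_edges \<union> cane_edges"
    using *[of s t] *[of t s] e ab(1) by (metis insert_commute linorder_neqE_nat)
qed

lemma card_cane_edges: "card cane_edges = (\<Sum>t\<le>n. length (waiting t))"
proof -
  let ?I = "SIGMA t:{..n}. set (waiting t)"
  have "cane_edges = (\<lambda>(t, u). {active t, u}) ` ?I" by (auto simp: cane_edges_def)
  \<comment> \<open>A waiting node becomes active later, so the unordered edge tells which of its
    ends is the active one.\<close>
  moreover have "inj_on (\<lambda>(t, u). {active t, u}) ?I"
  proof (rule inj_onI, clarsimp)
    fix s u t v assume *: "s \<le> n" "u \<in> set (waiting s)" "t \<le> n" "v \<in> set (waiting t)"
      "{active s, u} = {active t, v}"
    then obtain s' t' where "s < s'" "s' \<le> n" "u = active s'" "t < t'" "t' \<le> n" "v = active t'"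
      by (meson waiting_active)
    then show "s = t \<and> u = v" using * by (auto simp: doubleton_eq_iff active_eq_iff)
  qed
  ultimately have "card cane_edges = card ?I" by (simp add: card_image)
  also have "\<dots> = (\<Sum>t\<le>n. card (set (waiting t)))" by simp
  also have "\<dots> = (\<Sum>t\<le>n. length (waiting t))"
  proof (rule sum.cong)
    fix t assume "t \<in> {..n}"
    then show "card (set (waiting t)) = length (waiting t)"
      using distinct_visited[of t] by (intro distinct_card) (simp add: waiting_def)
  qed simp
  finally show ?thesis .
qed

text \<open>The node of a cycle that is activated last would have both its neighbours on the cycle
  as parents. But parents are unique, and the two neighbours differ because a cycle has at least
  three nodes.\<close>

lemma no_cycle_forest_edges: "\<not> graph_cycle forest_edges vs"
proof
  assume cyc: "graph_cycle forest_edges vs"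
  define \<tau> where "\<tau> v = (THE t. t \<le> n \<and> v = active t)" for v
  have \<tau>: "\<tau> (active t) = t" if "t \<le> n" for t
    unfolding \<tau>_def using that by (intro the_equality) (auto simp: active_eq_iff)
  have "vs \<noteq> []" using cyc by (auto simp: graph_cycle_def)
  then obtain v where v: "v \<in> set vs" "\<And>u. u \<in> set vs \<Longrightarrow> \<tau> u \<le> \<tau> v"
    using arg_max_nat_lemma[of "\<lambda>u. u \<in> set vs" "hd vs" \<tau> "Suc (Max (\<tau> ` set vs))"]
    by (auto simp: less_Suc_eq_le)
  then obtain xs ys where vs: "vs = xs @ v # ys" by (auto simp: in_set_conv_decomp)
  \<comment> \<open>The cycle opened at \<open>v\<close>: the first and the last node of this list
    are the neighbours of \<open>v\<close>.\<close>
  let ?ws = "ys @ xs"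
  have len: "length ?ws \<ge> 2" and dist: "distinct ?ws" and "v \<notin> set ?ws"
    using cyc by (auto simp: vs graph_cycle_def graph_path_def)
  have succ: "successively (\<lambda>u v. {u, v} \<in> forest_edges) (xs @ v # ys)"
    and last: "{last (xs @ v # ys), hd (xs @ v # ys)} \<in> forest_edges"
    using cyc by (auto simp: vs graph_cycle_def graph_path_def)
  have adj: "{v, hd ?ws} \<in> forest_edges" "{v, last ?ws} \<in> forest_edges"
  proof -
    show "{v, hd ?ws} \<in> forest_edges"
      using succ last len by (cases ys; cases xs)
        (simp_all add: successively_append_iff successively_Cons insert_commute)
    show "{v, last ?ws} \<in> forest_edges"
      using succ last len by (cases xs)
        (auto simp: successively_append_iff successively_Cons insert_commute split: if_splits)
  qed
  have ne: "?ws \<noteq> []" using len by fastforce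
  have "hd ?ws \<noteq> last ?ws"
    using len nth_eq_iff_index_eq[OF dist, of 0 "length ?ws - 1"]
    unfolding hd_conv_nth[OF ne] last_conv_nth[OF ne] by fastforce
  have "\<exists>t\<le>n. u = active t \<and> v \<in> fresh t" if u: "{v, u} \<in> forest_edges" "u \<in> set vs" for u
  proof -
    obtain t w where t: "{v, u} = {active t, w}" "t \<le> n" "w \<in> fresh t"
      using u(1) by (auto simp: forest_edges_def)
    show ?thesis
    proof (cases "w = v")
      case False
      then have "v = active t" "w = u" using t by (auto simp: doubleton_eq_iff)
      moreover obtain s where "t < s" "s \<le> n" "w = active s" using t fresh_active by blast
      ultimately have "\<tau> v < \<tau> u" using \<tau>[of s] \<tau>[of t] t by simp
      then show ?thesis using v(2)[OF u(2)] by simp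
    qed (use t in \<open>auto simp: doubleton_eq_iff\<close>)
  qed
  note parent = this
  have "set ?ws \<subseteq> set vs" by (auto simp: vs)
  then have "hd ?ws \<in> set vs" "last ?ws \<in> set vs" using hd_in_set[OF ne] last_in_set[OF ne] by auto
  then obtain s t where "s \<le> n" "hd ?ws = active s" "v \<in> fresh s"
    "t \<le> n" "last ?ws = active t" "v \<in> fresh t"
    using parent[OF adj(1)] parent[OF adj(2)] by blast
  then have "hd ?ws = last ?ws" using fresh_disjoint[of v s t] by simp
  then show False using \<open>hd ?ws \<noteq> last ?ws\<close> by simp
qed

lemma forest_edges_forest: "forest_edges \<in> labeled_forests n"
  using forest_edges_labeled no_cycle_forest_edges by (simp add: labeled_forests_def)

text \<open>The stack is empty whenever a new root is taken, so everything on it was reached by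
  search edges from the current root.\<close>

lemma current_component:
  assumes "t \<le> n" "v \<in> insert (active t) (set (waiting t))"
  shows "v \<in> graph_component forest_edges (current_root t)"
  using assms
proof (induction t arbitrary: v)
  case (Suc t)
  then have t: "t < n" by simp
  show ?case
  proof (cases "stack t = []")
    case True
    then show ?thesis using Suc.prems t by (auto simp: waiting_Suc)
  next
    case False
    have "v \<in> set (waiting (Suc t) @ [active (Suc t)])" using Suc.prems by auto
    then have "v \<in> set (stack t)" unfolding stack_snoc[OF t False] .
    then consider "v \<in> set (waiting t)" | "v \<in> fresh t" by (auto simp: stack_def)
    then show ?thesis
    proof cases
      case 2
      then have "{active t, v} \<in> forest_edges" using t by (intro forest_edgeI) auto
      moreover have "active t \<in> graph_component forest_edges (current_root t)"
        using Suc.IH[of "active t"] t by simp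
      ultimately show ?thesis
        using False by (auto simp: graph_component_def intro: rtrancl_into_rtrancl)
    qed (use Suc.IH[of v] t False in simp)
  qed
qed simp

lemma current_component_graph:
  assumes "t \<le> n" "v \<in> insert (active t) (set (waiting t))"
  shows "v \<in> graph_component G (current_root t)"
proof -
  have "graph_component forest_edges w \<subseteq> graph_component G w" for w
    unfolding graph_component_def using forest_edges_subset
    by (auto elim!: rtrancl_mono[THEN subsetD, rotated])
  then show ?thesis using current_component[OF assms] by blast
qed

lemma comp_root_current: "t \<le> n \<Longrightarrow> comp_root G (current_root t) = current_root t"
proof (induction t)
  case 0
  have "comp_root G (n+1) \<le> n+1"
    using comp_root_in_component[OF graph, of "n+1"] graph_component_subset_nodes[OF graph, of "n+1"]
    by auto
  moreover have "n+1 \<le> comp_root G (n+1)" using le_comp_root[OF graph, of "n+1"] by simp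
  ultimately show ?case by simp
next
  case (Suc t)
  then have t: "t < n" "search_invar t" using search_invar by auto
  show ?case
  proof (cases "stack t = []")
    case True
    have "comp_root G (Max (nodes - set (visited t))) = Max (nodes - set (visited t))"
      using comp_root_Max_unvisited[OF graph, of "set (visited t)"] visited_closed[OF t(2) True]
        unvisited_nonempty[OF t(2,1) True] by blast
    then show ?thesis using True t by (simp add: active_Suc_root)
  next
    case False
    then show ?thesis using Suc t by simp
  qed
qed

lemma comp_root_waiting:
  "t \<le> n \<Longrightarrow> v \<in> insert (active t) (set (waiting t)) \<Longrightarrow> comp_root G v = current_root t"
  using comp_root_eq[OF current_component_graph] comp_root_current by simp

lemma comp_root_fresh: "t \<le> n \<Longrightarrow> v \<in> fresh t \<Longrightarrow> comp_root G v = current_root t"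
  using comp_root_adjacent[of "active t" v G] comp_root_waiting[of t "active t"]
  by (simp add: fresh_def nbrs_def)

end

section \<open>Runs on different graphs with the same search forest\<close>

lemma nfs_step_cong:
  assumes "new (set vis) (last act) = new' (set vis) (last act)"
    and "new' (set vis) (last act) = {} \<Longrightarrow> filter (\<lambda>v. v \<notin> set act) vis = [] \<Longrightarrow>
      (R - set vis = {} \<longleftrightarrow> R' - set vis = {}) \<and>
      (R - set vis \<noteq> {} \<longrightarrow> Max (R - set vis) = Max (R' - set vis))"
  shows "nfs_step R new (vis, act, T) = nfs_step R' new' (vis, act, T)"
  using assms by (auto simp: nfs_step_def Let_def)

context labeled_graph
begin

lemma state_split: "state t = (visited t, activated t, search_edges t)"
  by (simp add: visited_def activated_def search_edges_def)

lemma state_Suc: "state (Suc t) = nfs_step nodes (\<lambda>A a. nbrs a - A) (state t)"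
  by (simp add: state_def)

lemma nfs_run_eq_state:
  assumes new: "\<And>t. t \<le> n \<Longrightarrow> new (set (visited t)) (active t) = fresh t"
  shows "nfs_run n (comp_roots n G) new = state (Suc n)"
proof -
  have "(nfs_step (comp_roots n G) new ^^ t) ([n+1], [n+1], {}) = state t" if "t \<le> Suc n" for t
    using that
  proof (induction t)
    case 0
    show ?case by (simp add: state_def)
  next
    case (Suc t)
    then have t: "t \<le> n" "search_invar t" using search_invar by auto
    have "nfs_step (comp_roots n G) new (state t) = nfs_step nodes (\<lambda>A a. nbrs a - A) (state t)"
      unfolding state_split
    proof (rule nfs_step_cong)
      show "new (set (visited t)) (last (activated t))
          = nbrs (last (activated t)) - set (visited t)"
        using new[OF t(1)] by (simp add: active_def fresh_def)
      assume "nbrs (last (activated t)) - set (visited t) = {}"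
        "filter (\<lambda>v. v \<notin> set (activated t)) (visited t) = []"
      then have "stack t = []"
        unfolding stack_eq_Nil by (simp add: fresh_def active_def waiting_def)
      then have "b \<in> set (visited t)" if "a \<in> set (visited t)" "{a, b} \<in> G" for a b
        using visited_closed[OF t(2)] that by blast
      then show "(comp_roots n G - set (visited t) = {}) = (nodes - set (visited t) = {}) \<and>
          (comp_roots n G - set (visited t) \<noteq> {} \<longrightarrow>
            Max (comp_roots n G - set (visited t)) = Max (nodes - set (visited t)))"
        using Max_unvisited_comp_roots[OF graph, of "set (visited t)"] by blast
    qed
    then show ?case using Suc by (simp add: state_Suc)
  qed
  from this[of "Suc n"] show ?thesis by (simp add: nfs_run_def)
qed

lemma nfs_forest_eq: "\<Phi> n G = forest_edges"
  unfolding nfs_forest_def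
  by (subst nfs_run_eq_state) (simp_all add: fresh_def nbrs_def state_Suc_n)

text \<open>By induction the two runs are in the same state, and there the unvisited neighbours of
  the active node are, in either graph, those joined to it by forest edges.\<close>

lemma state_determined:
  assumes H: "H \<in> labeled_graphs n" "forest_edges \<subseteq> H" "H \<subseteq> forest_edges \<union> cane_edges"
    and "t \<le> Suc n"
  shows "labeled_graph.state n H t = state t"
  using \<open>t \<le> Suc n\<close>
proof (induction t)
  interpret H: labeled_graph n H using H(1) by unfold_locales
  case 0
  show ?case by (simp add: state_def H.state_def)
next
  interpret H: labeled_graph n H using H(1) by unfold_locales
  case (Suc t)
  have "H.nbrs (active t) - set (visited t) = nbrs (active t) - set (visited t)"
  proof (intro set_eqI)
    fix u
    have "u \<in> fresh t \<longleftrightarrow> {active t, u} \<in> forest_edges" if "u \<notin> set (visited t)"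
      using forest_edge_unvisited[of t u] that Suc.prems forest_edgeI[of t u] by auto
    moreover have "{active t, u} \<notin> cane_edges" if "u \<notin> set (visited t)"
      using cane_edge_visited[of t u] that Suc.prems by auto
    ultimately show "u \<in> H.nbrs (active t) - set (visited t)
        \<longleftrightarrow> u \<in> nbrs (active t) - set (visited t)"
      using H(2,3) unfolding fresh_def H.nbrs_def by blast
  qed
  then have "nfs_step nodes (\<lambda>A a. H.nbrs a - A) (state t) = nfs_step nodes (\<lambda>A a. nbrs a - A) (state t)"
    unfolding state_split by (intro nfs_step_cong) (auto simp: active_def)
  then show ?case using Suc by (simp add: state_Suc H.state_Suc)
qed

lemma edges_determined:
  assumes H: "H \<in> labeled_graphs n" "forest_edges \<subseteq> H" "H \<subseteq> forest_edges \<union> cane_edges"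
  shows "labeled_graph.forest_edges n H = forest_edges"
    and "labeled_graph.cane_edges n H = cane_edges"
proof -
  interpret H: labeled_graph n H using H(1) by unfold_locales
  have st: "H.state t = state t" if "t \<le> Suc n" for t
    using state_determined[OF H that] .
  show "H.forest_edges = forest_edges"
    using st[of "Suc n"] by (simp add: H.state_Suc_n state_Suc_n)
  have "H.active t = active t \<and> H.waiting t = waiting t" if "t \<le> n" for t
    using st[of t] that
    by (simp add: active_def H.active_def activated_def H.activated_def waiting_def H.waiting_def
        visited_def H.visited_def)
  then have "{active t, u} = e \<and> t \<le> n \<and> u \<in> set (waiting t)
      \<longleftrightarrow> {H.active t, u} = e \<and> t \<le> n \<and> u \<in> set (H.waiting t)" for t u e
    by auto
  then show "H.cane_edges = cane_edges"
    unfolding H.cane_edges_def cane_edges_def by (metis (no_types, lifting))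
qed

end

section \<open>Searching a forest\<close>

locale labeled_forest = labeled_graph +
  assumes acyclic: "\<not> graph_cycle G vs"
begin

text \<open>Both ends of a cane edge lie in one component of the search forest, so a forest path
  between them and the edge would close a cycle.\<close>

lemma cane_edge_not_in: "G \<inter> cane_edges = {}"
proof -
  have False if t: "t \<le> n" "u \<in> set (waiting t)" and edge: "{active t, u} \<in> G" for t u
  proof -
    let ?R = "{(a, b). {a, b} \<in> forest_edges}"
    have "active t \<in> graph_component forest_edges (current_root t)"
      "u \<in> graph_component forest_edges (current_root t)"
      using current_component t by auto
    then have "graph_component forest_edges u = graph_component forest_edges (active t)"
      by (simp add: graph_component_eq)
    then have path: "(u, active t) \<in> ?R\<^sup>*"
      using self_in_graph_component[of "active t" forest_edges] unfolding graph_component_def by blast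
    obtain vs where vs: "graph_path forest_edges vs" "hd vs = u" "last vs = active t"
      using exists_graph_path[OF path] by blast
    have ne: "u \<noteq> active t" using waiting_disjoint t by auto
    have "{u, active t} \<notin> forest_edges"
      using forest_cane_disjoint cane_edgeI[OF t] by (auto simp: insert_commute)
    \<comment> \<open>The ends are distinct and not joined by a forest edge, so the path has an
      inner node and the cycle its three nodes.\<close>
    with ne vs have "length vs \<ge> 3"
      by (cases vs; cases "tl vs"; cases "tl (tl vs)") (auto simp: graph_path_def)
    moreover have "graph_path G vs"
      using vs(1) forest_edges_subset
      by (auto simp: graph_path_def intro: successively_mono)
    ultimately have "graph_cycle G vs"
      using vs edge by (simp add: graph_cycle_def)
    then show False using acyclic by blast
  qed
  then show ?thesis by (auto simp: cane_edges_def)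
qed

lemma graph_eq: "G = forest_edges"
  using graph_subset forest_edges_subset cane_edge_not_in by blast

text \<open>Parenthood read off from the search; \<open>is_parent_iff\<close> identifies it with the
  definition by paths to the root.\<close>

definition "tree_parent p v \<longleftrightarrow> (\<exists>t\<le>n. p = active t \<and> v \<in> fresh t)"

lemma tree_parent_active [simp]: "t \<le> n \<Longrightarrow> tree_parent (active t) v \<longleftrightarrow> v \<in> fresh t"
  by (auto simp: tree_parent_def active_eq_iff)

lemma tree_parent_unique: "tree_parent p v \<Longrightarrow> tree_parent q v \<Longrightarrow> p = q"
  using fresh_disjoint by (auto simp: tree_parent_def)

lemma edge_tree_parent: "{a, b} \<in> G \<longleftrightarrow> tree_parent a b \<or> tree_parent b a"
proof -
  have "{a, b} \<in> forest_edges \<longleftrightarrow> tree_parent a b \<or> tree_parent b a"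
    by (auto simp: forest_edges_def tree_parent_def doubleton_eq_iff)
  then show ?thesis using graph_eq by simp
qed

text \<open>A path that begins with a step from parent to child never turns upwards, since each node
  has only one parent and a path does not return to it. So it cannot end in a root.\<close>

lemma descending_path:
  assumes "graph_path G (u # w # vs)" "tree_parent u w"
  shows "\<exists>x. tree_parent x (last (w # vs))"
  using assms
proof (induction vs arbitrary: u w)
  case (Cons x vs)
  then have "{w, x} \<in> G" "x \<noteq> u" by (auto simp: graph_path_def)
  then have "tree_parent w x"
    using edge_tree_parent[of w x] Cons.prems tree_parent_unique by blast
  moreover have "graph_path G (w # x # vs)" using Cons.prems by (auto simp: graph_path_def)
  ultimately show ?case using Cons.IH[of w x] by auto
qed auto

lemma root_not_fresh: "t \<le> n \<Longrightarrow> v \<in> fresh t \<Longrightarrow> comp_root G v \<noteq> v"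
  using comp_root_fresh[of t v] current_root_visited[of t] fresh_unvisited[of v t] by auto

lemma root_no_parent: "\<not> tree_parent p (comp_root G v)" if "v \<in> nodes"
proof
  assume "tree_parent p (comp_root G v)"
  moreover have "comp_root G (comp_root G v) = comp_root G v"
    using comp_root_eq[OF comp_root_in_component[OF graph that]] .
  ultimately show False using root_not_fresh by (auto simp: tree_parent_def)
qed

text \<open>The last conjunct strengthens the induction: the other nodes of the path were active
  earlier, so a child can be put in front without repetition.\<close>

lemma path_to_root:
  assumes "t \<le> n"
  shows "\<exists>vs. graph_path G (active t # vs) \<and> last (active t # vs) = current_root t \<and>
    set vs \<subseteq> active ` {..<t}"
  using assms
proof (induction t rule: less_induct)
  case (less t)
  show ?case
  proof (cases "active t = current_root t")
    case True
    then show ?thesis by (intro exI[of _ "[]"]) (simp add: graph_path_def)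
  next
    case False
    then obtain s where s: "s < t" "active t \<in> fresh s" using active_cases less.prems by blast
    with less obtain vs where vs: "graph_path G (active s # vs)"
      "last (active s # vs) = current_root s" "set vs \<subseteq> active ` {..<s}"
      by (meson less_le_trans less_imp_le)
    have "comp_root G (active t) = current_root s"
      using s less.prems by (intro comp_root_fresh) auto
    moreover have "comp_root G (active t) = current_root t"
      using less.prems by (intro comp_root_waiting) auto
    ultimately have "current_root s = current_root t" by metis
    moreover have "active t \<noteq> active r" if "r \<le> s" for r
      using active_eq_iff[of t r] that s(1) less.prems by simp
    then have "active t \<notin> active ` {..s}" by blast
    then have "active t \<notin> set (active s # vs)" using vs(3) by auto
    moreover have "{active t, active s} \<in> G"
      using s less.prems by (simp add: edge_tree_parent)
    ultimately have "graph_path G (active t # active s # vs)"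
      "last (active t # active s # vs) = current_root t" "set (active s # vs) \<subseteq> active ` {..<t}"
      using vs s by (auto simp: graph_path_def)
    then show ?thesis by blast
  qed
qed

lemma is_parent_iff: "is_parent G p v \<longleftrightarrow> tree_parent p v"
proof
  assume "is_parent G p v"
  then obtain vs where vs: "graph_path G (v # p # vs)" "last (p # vs) = comp_root G v"
    by (auto simp: is_parent_def)
  then have "{v, p} \<in> G" by (simp add: graph_path_def)
  then have "v \<in> nodes" "tree_parent v p \<or> tree_parent p v"
    using labeled_graph_edgeD[OF graph] edge_tree_parent by blast+
  \<comment> \<open>Otherwise the path from \<open>v\<close> to the root would begin with a step
    down to a child and hence end in a node with a parent.\<close>
  then show "tree_parent p v" using descending_path[OF vs(1)] vs(2) root_no_parent by metis
next
  assume "tree_parent p v"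
  then obtain t where t: "t \<le> n" "p = active t" "v \<in> fresh t" by (auto simp: tree_parent_def)
  obtain vs where vs: "graph_path G (active t # vs)" "last (active t # vs) = current_root t"
    "set vs \<subseteq> active ` {..<t}"
    using path_to_root t by blast
  have "v \<notin> active ` {..t}" using t fresh_unvisited active_visited by blast
  then have "v \<notin> set (active t # vs)" using vs(3) by auto
  then have "graph_path G (v # p # vs)"
    using vs t edge_tree_parent[of v p] \<open>tree_parent p v\<close> by (auto simp: graph_path_def)
  moreover have "last (p # vs) = comp_root G v"
    using vs t comp_root_fresh by simp
  ultimately show "is_parent G p v" unfolding is_parent_def by blast
qed

lemma children_active [simp]: "t \<le> n \<Longrightarrow> children G (active t) = fresh t"
  by (simp add: children_def is_parent_iff)

lemma nfs_order_eq: "nfs_order n G = visited n"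
  unfolding nfs_order_def by (subst nfs_run_eq_state) (simp_all add: state_Suc_n)

end

section \<open>Cane paths\<close>

text \<open>This turns the indexed definition into a recursion over the parent, the form in which
  cane paths are counted along the stack.\<close>

lemma cane_path_Cons:
  "cane_path F (v # p # vs) \<longleftrightarrow>
    is_parent F p v \<and> ((\<exists>u. vs = [u] \<and> u \<in> children F p \<and> v < u) \<or> cane_path F (p # vs))"
proof (cases vs)
  case Nil
  then show ?thesis by (auto simp: cane_path_def)
next
  case (Cons u us)
  show ?thesis
  proof (cases us)
    case Nil
    have "k = 2" if "length [v, p, u] = k + 1" for k using that by simp
    then show ?thesis using Nil \<open>vs = u # us\<close> unfolding cane_path_def
      by (auto simp: less_Suc_eq numeral_2_eq_2)
  next
    case (Cons w ws)
    \<comment> \<open>The definition of \<open>cane_path\<close> with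
      \<open>k = length xs - 1\<close> put in, for lists long enough that no subtraction is cut off
      at 0.\<close>
    let ?P = "\<lambda>xs. (\<forall>i<length xs - 2. is_parent F (xs ! (i+1)) (xs ! i)) \<and>
      xs ! (length xs - 1) \<in> children F (xs ! (length xs - 2)) \<and>
      xs ! (length xs - 1) > xs ! (length xs - 3)"
    have *: "cane_path F xs \<longleftrightarrow> ?P xs" if "length xs \<ge> 3" for xs
      unfolding cane_path_def using that
      by (auto intro!: exI[of _ "length xs - 1"] simp: numeral_3_eq_3 numeral_2_eq_2)
    have "cane_path F (v # p # vs) \<longleftrightarrow> is_parent F p v \<and> cane_path F (p # vs)"
      using \<open>vs = u # us\<close> Cons
      by (simp add: * All_less_Suc2 nth_Cons' del: nth_Cons_Suc)
    then show ?thesis using \<open>vs = u # us\<close> Cons by simp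
  qed
qed

lemma cane_path_shapeE:
  assumes "cane_path F vs" obtains v p us where "vs = v # p # us" "is_parent F p v"
proof -
  have "length vs \<ge> 2" using assms by (auto simp: cane_path_def)
  then obtain v p us where "vs = v # p # us"
    by (metis One_nat_def Suc_1 Suc_le_length_iff)
  then show ?thesis using that assms cane_path_Cons by blast
qed

text \<open>For \<open>pushed t\<close> it says that the index of a node is the number of its larger
  siblings, hence of its cane paths with three nodes.\<close>

lemma card_greater_nth_rev_sorted:
  fixes S :: "'a::linorder set"
  assumes "finite S" "i < card S"
  shows "card {u \<in> S. u > rev (sorted_list_of_set S) ! i} = i"
proof -
  let ?xs = "rev (sorted_list_of_set S)"
  have desc: "sorted_wrt (>) ?xs" by (simp add: sorted_wrt_rev)
  have len: "length ?xs = card S" using assms by simp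
  have gt: "?xs ! j > ?xs ! i \<longleftrightarrow> j < i" if "j < card S" for j
    using sorted_wrt_nth_less[OF desc, of i j] sorted_wrt_nth_less[OF desc, of j i] that assms len
    by (metis linorder_less_linear not_less_iff_gr_or_eq)
  have "set ?xs = S" using assms by simp
  then have S: "u \<in> S \<longleftrightarrow> (\<exists>j<card S. ?xs ! j = u)" for u
    using in_set_conv_nth[of u ?xs] len by metis
  have "{u \<in> S. u > ?xs ! i} = (!) ?xs ` {j \<in> {..<card S}. ?xs ! j > ?xs ! i}"
    unfolding S by blast
  also have "{j \<in> {..<card S}. ?xs ! j > ?xs ! i} = {..<i}"
    using gt assms(2) by (auto simp del: rev_nth)
  finally have "{u \<in> S. u > ?xs ! i} = (!) ?xs ` {..<i}" .
  moreover have "inj_on ((!) ?xs) {..<i}"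
    using assms by (intro inj_onI) (simp add: nth_eq_iff_index_eq del: rev_nth)
  ultimately show ?thesis by (simp add: card_image)
qed

context labeled_forest
begin

definition "canes v = {vs. cane_path G vs \<and> hd vs = v}"

lemma canes_from_eq: "canes_from G v = card (canes v)"
  by (simp add: canes_from_def canes_def)

lemma canes_no_parent: "(\<And>p. \<not> tree_parent p v) \<Longrightarrow> canes v = {}"
  by (auto simp: canes_def is_parent_iff elim!: cane_path_shapeE)

lemma canes_parent:
  assumes "tree_parent p v"
  shows "canes v = (\<lambda>u. [v, p, u]) ` {u \<in> children G p. u > v} \<union> (#) v ` canes p"
proof (intro set_eqI iffI)
  fix vs assume "vs \<in> canes v"
  then have vs: "cane_path G vs" "hd vs = v" by (auto simp: canes_def)
  then obtain q us where q: "vs = v # q # us" "is_parent G q v"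
    by (metis cane_path_shapeE list.sel(1))
  then have "q = p" using assms tree_parent_unique is_parent_iff by blast
  then show "vs \<in> (\<lambda>u. [v, p, u]) ` {u \<in> children G p. u > v} \<union> (#) v ` canes p"
    using vs(1) q(1) cane_path_Cons[of G v p us] by (auto simp: canes_def)
next
  fix vs assume "vs \<in> (\<lambda>u. [v, p, u]) ` {u \<in> children G p. u > v} \<union> (#) v ` canes p"
  then consider u where "vs = [v, p, u]" "u \<in> children G p" "u > v"
    | us where "vs = v # us" "cane_path G us" "hd us = p"
    by (auto simp: canes_def)
  then show "vs \<in> canes v"
  proof cases
    case 1
    then show ?thesis using assms by (simp add: canes_def is_parent_iff cane_path_Cons)
  next
    case 2
    then obtain ws where "us = p # ws" by (metis cane_path_shapeE list.sel(1))
    then show ?thesis using 2 assms by (simp add: canes_def is_parent_iff cane_path_Cons)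
  qed
qed

lemma card_canes_parent:
  assumes "tree_parent p v" "finite (canes p)"
  shows "finite (canes v)" "card (canes v) = card {u \<in> children G p. u > v} + card (canes p)"
proof -
  have fin: "finite (children G p)"
    using assms by (auto simp: tree_parent_def)
  \<comment> \<open>The two families are told apart by their tails: \<open>[p, u]\<close> is too
    short to be a cane path.\<close>
  have "(\<lambda>u. [v, p, u]) ` {u \<in> children G p. u > v} \<inter> (#) v ` canes p = {}"
  proof -
    have "\<not> cane_path G [p, u]" for u by (simp add: cane_path_def)
    then show ?thesis by (auto simp: canes_def)
  qed
  then show "card (canes v) = card {u \<in> children G p. u > v} + card (canes p)"
    using fin assms by (simp add: canes_parent card_Un_disjoint card_image inj_on_def)
  show "finite (canes v)" using fin assms by (simp add: canes_parent)
qed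

lemma canes_pushed:
  assumes t: "t \<le> n" and fin: "finite (canes (active t))" and i: "i < length (pushed t)"
  shows "finite (canes (pushed t ! i))"
    and "card (canes (pushed t ! i)) = i + card (canes (active t))"
proof -
  have "pushed t ! i \<in> fresh t" using i nth_mem by fastforce
  then have p: "tree_parent (active t) (pushed t ! i)" using t by simp
  have "card {u \<in> fresh t. u > pushed t ! i} = i"
    using i card_greater_nth_rev_sorted[of "fresh t" i] by (simp add: pushed_def)
  then show "finite (canes (pushed t ! i))"
    "card (canes (pushed t ! i)) = i + card (canes (active t))"
    using card_canes_parent[OF p fin] t by auto
qed

lemma current_root_no_parent: "t \<le> n \<Longrightarrow> \<not> tree_parent p (current_root t)"
  using root_not_fresh comp_root_current by (auto simp: tree_parent_def)

text \<open>An active node at height \<open>h\<close> has \<open>h\<close> cane paths and is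
  replaced by its children in decreasing order. The child with \<open>i\<close> larger siblings
  lands at height \<open>h + i\<close>, and by the recursion it has \<open>h + i\<close> cane paths.
  The nodes below keep their places.\<close>

lemma canes_stack:
  assumes "t \<le> n" "i \<le> length (waiting t)"
  shows "finite (canes ((waiting t @ [active t]) ! i)) \<and> card (canes ((waiting t @ [active t]) ! i)) = i"
  using assms
proof (induction t arbitrary: i)
  case 0
  then show ?case using canes_no_parent[of "n+1"] current_root_no_parent[of 0] by simp
next
  case (Suc t)
  then have t: "t < n" by simp
  show ?case
  proof (cases "stack t = []")
    case True
    then show ?thesis
      using Suc.prems canes_no_parent[of "active (Suc t)"] current_root_no_parent[of "Suc t"]
      by (simp add: waiting_Suc_root)
  next
    case False
    have i: "i < length (stack t)" using Suc.prems stack_snoc[OF t False]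
      by (metis le_imp_less_Suc length_append_singleton)
    have act: "finite (canes (active t))" "card (canes (active t)) = length (waiting t)"
      using Suc.IH[of "length (waiting t)"] t by auto
    show ?thesis unfolding stack_snoc[OF t False]
    proof (cases "i < length (waiting t)")
      case True
      then show "finite (canes (stack t ! i)) \<and> card (canes (stack t ! i)) = i"
        using Suc.IH[of i] t by (simp add: stack_def nth_append)
    next
      case False
      then show "finite (canes (stack t ! i)) \<and> card (canes (stack t ! i)) = i"
        using canes_pushed[of t "i - length (waiting t)"] act t i by (simp add: stack_def nth_append)
    qed
  qed
qed

lemma canes_active: "t \<le> n \<Longrightarrow> finite (canes (active t))"
  "t \<le> n \<Longrightarrow> canes_from G (active t) = length (waiting t)"
  using canes_stack[of t "length (waiting t)"] by (auto simp: canes_from_eq)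

lemma canes_from_pushed:
  "t \<le> n \<Longrightarrow> i < length (pushed t) \<Longrightarrow> canes_from G (pushed t ! i) = length (waiting t) + i"
  using canes_pushed[of t i] canes_active[of t] by (simp add: canes_from_eq)

lemma cane_number_eq: "\<alpha> G = (\<Sum>v\<in>nodes. canes_from G v)"
proof -
  have "{vs. cane_path G vs} = (\<Union>v\<in>nodes. canes v)"
  proof -
    have "hd vs \<in> nodes" if "cane_path G vs" for vs
      using that labeled_graph_edgeD[OF graph]
      by (auto simp: is_parent_def graph_path_def elim!: cane_path_shapeE)
    then show ?thesis by (auto simp: canes_def)
  qed
  moreover have "card (\<Union>v\<in>nodes. canes v) = (\<Sum>v\<in>nodes. card (canes v))"
  proof (rule card_UN_disjoint)
    show "\<forall>v\<in>nodes. finite (canes v)"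
    proof
      fix v assume "v \<in> nodes"
      then obtain t where "t \<le> n" "v = active t" by (rule node_active)
      then show "finite (canes v)" using canes_active(1) by simp
    qed
    show "\<forall>v\<in>nodes. \<forall>w\<in>nodes. v \<noteq> w \<longrightarrow> canes v \<inter> canes w = {}"
      by (auto simp: canes_def)
  qed simp
  ultimately show ?thesis by (simp add: cane_number_def canes_from_eq)
qed

section \<open>Graphs with a given search forest\<close>

lemma card_cane_edges_eq: "card cane_edges = \<alpha> G"
proof -
  have "\<alpha> G = (\<Sum>t\<le>n. canes_from G (active t))"
    unfolding cane_number_eq active_image[symmetric] by (simp add: sum.reindex inj_on_active)
  then show ?thesis by (simp add: card_cane_edges canes_active)
qed

lemma nfs_fiber: "{H \<in> labeled_graphs n. \<Phi> n H = G} = (\<union>) G ` Pow cane_edges"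
proof (intro set_eqI iffI)
  fix H assume "H \<in> {H \<in> labeled_graphs n. \<Phi> n H = G}"
  then have H: "H \<in> labeled_graphs n" "\<Phi> n H = G" by auto
  interpret H: labeled_graph n H using H(1) by unfold_locales
  have "H.forest_edges = G" using H.nfs_forest_eq H(2) by simp
  \<comment> \<open>Here \<open>edges_determined\<close> is used with \<open>H\<close> as the base
    graph and its search forest \<open>G\<close> as the graph compared with it.\<close>
  moreover have "cane_edges = H.cane_edges"
    using H.edges_determined(2)[of G] graph \<open>H.forest_edges = G\<close> by simp
  ultimately have "G \<subseteq> H" "H \<subseteq> G \<union> cane_edges"
    using H.forest_edges_subset H.graph_subset by auto
  then show "H \<in> (\<union>) G ` Pow cane_edges" by (auto intro!: image_eqI[of _ _ "H - G"])
next
  fix H assume "H \<in> (\<union>) G ` Pow cane_edges"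
  then have H: "G \<subseteq> H" "H \<subseteq> G \<union> cane_edges" by auto
  then have "H \<in> labeled_graphs n"
    using graph cane_edges_labeled unfolding labeled_graphs_def by blast
  moreover from this interpret H: labeled_graph n H by unfold_locales
  have "H.forest_edges = forest_edges"
    using edges_determined(1)[of H] H calculation by (simp flip: graph_eq)
  then have "\<Phi> n H = G" using H.nfs_forest_eq graph_eq by simp
  ultimately show "H \<in> {H \<in> labeled_graphs n. \<Phi> n H = G}" by simp
qed

lemma card_nfs_fiber: "card {H \<in> labeled_graphs n. \<Phi> n H = G} = 2 ^ \<alpha> G"
proof -
  have "finite cane_edges"
  proof (rule finite_subset)
    show "cane_edges \<subseteq> Pow nodes" using cane_edges_labeled by (auto simp: labeled_graphs_def)
  qed simp
  moreover have "inj_on ((\<union>) G) (Pow cane_edges)"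
    using cane_edge_not_in by (intro inj_onI) blast
  ultimately have "card ((\<union>) G ` Pow cane_edges) = 2 ^ card cane_edges"
    by (simp add: card_image card_Pow)
  then show ?thesis unfolding nfs_fiber card_cane_edges_eq .
qed

text \<open>While a node sits at height \<open>i\<close>, everything visited after it has been
  pushed above it. For the active node this means that only nodes of greater height come between it
  and its first child in the order.\<close>

lemma canes_above_stack:
  assumes "t \<le> n" "i \<le> length (waiting t)" "visited t ! p = (waiting t @ [active t]) ! i"
    and "p < q" "q < length (visited t)"
  shows "canes_from G (visited t ! q) > i"
  using assms
proof (induction t arbitrary: i p q)
  case (Suc t)
  then have t: "t < n" by simp
  show ?case
  proof (cases "stack t = []")
    case True
    then have v: "visited (Suc t) = visited t @ [active (Suc t)]" and "waiting (Suc t) = []"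
      using t by (simp_all add: visited_Suc waiting_Suc_root)
    then have "active (Suc t) = visited t ! p" "p < length (visited t)"
      using Suc.prems by (auto simp: nth_append split: if_splits)
    then show ?thesis using active_Suc_root_unvisited[OF t True] by simp
  next
    case False
    have v: "visited (Suc t) = visited t @ pushed t" using False t by (simp add: visited_Suc)
    have eq: "visited (Suc t) ! p = stack t ! i" using Suc.prems(3) stack_snoc[OF t False] by simp
    have i: "i < length (stack t)" using Suc.prems(2) stack_snoc[OF t False]
      by (metis le_imp_less_Suc length_append_singleton)
    show ?thesis
    proof (cases "i < length (waiting t)")
      case True
      have p: "p < length (visited t)"
      proof (rule ccontr)
        assume "\<not> p < length (visited t)"
        then have "pushed t ! (p - length (visited t)) = waiting t ! i"
          and "p - length (visited t) < length (pushed t)"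
          using eq True v Suc.prems(4,5) by (auto simp: stack_def nth_append)
        then have "waiting t ! i \<in> fresh t" by (metis nth_mem set_pushed)
        moreover have "waiting t ! i \<in> set (visited t)" using True nth_mem[OF True]
          unfolding waiting_def by auto
        ultimately show False using fresh_unvisited by blast
      qed
      show ?thesis
      proof (cases "q < length (visited t)")
        case q: True
        have "visited t ! p = (waiting t @ [active t]) ! i"
          using eq p True v by (simp add: stack_def nth_append)
        then show ?thesis using Suc.IH[of i p q] True t q v Suc.prems(4) by (simp add: nth_append)
      next
        case q: False
        then show ?thesis
          using Suc.prems(5) v canes_from_pushed[of t "q - length (visited t)"] t True
          by (simp add: nth_append)
      qed
    next
      case False
      define j where "j = i - length (waiting t)"
      have j: "j < length (pushed t)" and ij: "i = length (waiting t) + j" "stack t ! i = pushed t ! j"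
        using False i by (auto simp: j_def stack_def nth_append)
      \<comment> \<open>The node has just been pushed, so distinctness fixes its position
        \<open>p\<close>, and the later positions hold nodes pushed above it.\<close>
      have "visited (Suc t) ! (length (visited t) + j) = visited (Suc t) ! p"
        using eq ij v by (simp add: nth_append)
      then have "p = length (visited t) + j"
        using distinct_visited[of "Suc t"] Suc.prems j v nth_eq_iff_index_eq[of "visited (Suc t)"]
        by (metis add_less_cancel_left length_append less_trans)
      then show ?thesis
        using Suc.prems(4,5) v canes_from_pushed[of t "q - length (visited t)"] t ij
        by (simp add: nth_append)
    qed
  qed
qed simp

section \<open>Consecutive positions in the search order\<close>

lemma unvisited_less_root:
  "t \<le> n \<Longrightarrow> x \<in> nodes - set (visited t) \<Longrightarrow> x < current_root t"
proof (induction t)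
  case (Suc t)
  then have t: "t < n" by simp
  have x: "x \<in> nodes - set (visited t)" using Suc.prems visited_mono[of t "Suc t"] by auto
  show ?case
  proof (cases "stack t = []")
    case True
    have "x \<le> active (Suc t)" using x active_Suc_root[OF t True] by simp
    moreover have "x \<noteq> active (Suc t)" using Suc.prems active_visited[of "Suc t" "Suc t"] by auto
    ultimately show ?thesis using True by simp
  qed (use Suc x in simp)
qed auto

lemma comp_root_last_visited: "t \<le> n \<Longrightarrow> comp_root G (last (visited t)) = current_root t"
proof (induction t)
  case 0
  then show ?case using comp_root_current[of 0] by simp
next
  case (Suc t)
  then have t: "t < n" by simp
  consider "stack t = []" | "stack t \<noteq> []" "fresh t = {}" | "stack t \<noteq> []" "fresh t \<noteq> {}" by blast
  then show ?case
  proof cases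
    case 1
    then show ?thesis using comp_root_current[of "Suc t"] t by (simp add: visited_Suc)
  next
    case 2
    then have "pushed t = []" by simp
    then show ?thesis using 2 Suc t by (simp add: visited_Suc)
  next
    case 3
    then have "last (pushed t) \<in> fresh t" using last_in_set[of "pushed t"] by simp
    then show ?thesis using 3 comp_root_fresh[of t] t by (simp add: visited_Suc)
  qed
qed

text \<open>The facts about the order used later rest on these three cases. Of the nodes visited
  from an active node, the first inherits its height, and each further one is a smaller sibling one
  higher. In the case \<open>first_child\<close> the parent is at the last earlier position whose
  height does not exceed that of the node.\<close>

lemma nfs_order_cases:
  assumes "0 < q" "q \<le> n"
  defines "v \<equiv> nfs_order n G ! q" and "u \<equiv> nfs_order n G ! (q - 1)"
  obtains (root) "comp_root G v = v" "v < comp_root G u"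
  | (first_child) p where "comp_root G v \<noteq> v" "comp_root G v = comp_root G u" "p < q"
      "tree_parent (nfs_order n G ! p) v" "canes_from G (nfs_order n G ! p) = canes_from G v"
      "\<And>r. p < r \<Longrightarrow> r < q \<Longrightarrow> canes_from G v < canes_from G (nfs_order n G ! r)"
  | (sibling) p where "comp_root G v \<noteq> v" "comp_root G v = comp_root G u" "comp_root G u \<noteq> u"
      "tree_parent p u" "tree_parent p v" "v < u" "canes_from G v = Suc (canes_from G u)"
proof -
  \<comment> \<open>The first time at which position \<open>q\<close> is filled. It is positive
    since only one node is visited at time 0, so the node came in during the step \<open>s\<close>
    before it.\<close>
  define t where "t = (LEAST t. q < length (visited t))"
  have "q < length (visited t)" and "t \<le> n" and least: "\<And>s. s < t \<Longrightarrow> length (visited s) \<le> q"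
    using LeastI[of "\<lambda>t. q < length (visited t)" n] Least_le[of "\<lambda>t. q < length (visited t)" n]
      length_visited_n assms not_less_Least[of _ "\<lambda>t. q < length (visited t)"]
    by (auto simp: t_def not_less)
  obtain s where "t = Suc s" using \<open>q < length (visited t)\<close> assms(1) by (cases t) auto
  then have s: "s < n" "length (visited s) \<le> q" "q < length (visited (Suc s))"
    using \<open>q < length (visited t)\<close> \<open>t \<le> n\<close> least[of s] by auto
  have sub: "nfs_order n G ! r = visited (Suc s) ! r" if "r \<le> q" for r
  proof -
    obtain l where "visited n = visited (Suc s) @ l" using visited_prefix[of "Suc s" n] s by auto
    then show ?thesis using that s by (simp add: nfs_order_eq nth_append)
  qed
  have before: "nfs_order n G ! r = visited s ! r" if "r < length (visited s)" for r
    using sub[of r] s that by (simp add: visited_Suc nth_append)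
  have ne: "visited s \<noteq> []" using active_visited[of s s] s by auto
  have u0: "u = last (visited s)" if "q = length (visited s)"
    using before[of "q - 1"] ne that by (simp add: u_def last_conv_nth)
  have root_last: "comp_root G (last (visited s)) = current_root s"
    using comp_root_last_visited[of s] s by simp
  show ?thesis
  proof (cases "stack s = []")
    case True
    then have q: "q = length (visited s)" using s by (simp add: visited_Suc)
    then have v: "v = active (Suc s)" using True s sub[of q] by (simp add: v_def visited_Suc)
    have "comp_root G v = v" using comp_root_current[of "Suc s"] True s v by simp
    moreover have "v < comp_root G u"
      using unvisited_less_root[of s v] active_Suc_root_unvisited[OF s(1) True] s v u0[OF q] root_last
      by simp
    ultimately show ?thesis by (rule root)
  next
    case False
    define i where "i = q - length (visited s)"
    have i: "i < length (pushed s)" and v: "v = pushed s ! i"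
      using s False sub[of q] by (auto simp: i_def v_def visited_Suc nth_append)
    have vf: "v \<in> fresh s" using v nth_mem[OF i] by simp
    have vroot: "comp_root G v = current_root s" "comp_root G v \<noteq> v"
      using comp_root_fresh[of s v] root_not_fresh[of s v] vf s by auto
    have cv: "canes_from G v = length (waiting s) + i" using canes_from_pushed[of s i] i s v by simp
    show ?thesis
    proof (cases i)
      case 0
      then have q: "q = length (visited s)" using s i_def by simp
      obtain p where p: "p < length (visited s)" "visited s ! p = active s"
        using active_visited[of s s] s by (auto simp: in_set_conv_nth)
      show ?thesis
      proof (rule first_child)
        show "comp_root G v \<noteq> v" by fact
        show "comp_root G v = comp_root G u" using vroot u0[OF q] root_last by simp
        show "p < q" using p q by simp
        show "tree_parent (nfs_order n G ! p) v" using before[of p] p vf s by simp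
        show "canes_from G (nfs_order n G ! p) = canes_from G v"
          using before[of p] p cv 0 canes_active(2)[of s] s by simp
        fix r assume "p < r" "r < q"
        then show "canes_from G v < canes_from G (nfs_order n G ! r)"
          using canes_above_stack[of s "length (waiting s)" p r] s p q cv 0 before[of r] by simp
      qed
    next
      case (Suc j)
      have qj: "q = Suc (length (visited s) + j)" using Suc s by (simp add: i_def)
      have u: "u = pushed s ! j"
        using sub[of "q - 1"] s False by (simp add: u_def visited_Suc nth_append qj)
      have j: "j < length (pushed s)" using i Suc by simp
      have uf: "u \<in> fresh s" using u nth_mem[OF j] by simp
      show ?thesis
      proof (rule sibling)
        show "comp_root G v \<noteq> v" by fact
        show "comp_root G v = comp_root G u" "comp_root G u \<noteq> u"
          using vroot comp_root_fresh[of s u] root_not_fresh[of s u] uf s by auto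
        show "tree_parent (active s) u" "tree_parent (active s) v" using uf vf s by auto
        have "sorted_wrt (>) (pushed s)" by (simp add: pushed_def sorted_wrt_rev)
        then show "v < u" using sorted_wrt_nth_less[of "(>)" "pushed s" j i] i Suc u v by simp
        show "canes_from G v = Suc (canes_from G u)"
          using cv canes_from_pushed[of s j] j s u Suc by simp
      qed
    qed
  qed
qed

end

section \<open>Triangular maps and simplices\<close>

lemma nn_integral_lborel_split:
  fixes b :: "'a::euclidean_space" and h :: "'a \<Rightarrow> ennreal"
  assumes b: "b \<in> Basis" and h[measurable]: "h \<in> borel_measurable borel"
  shows "(\<integral>\<^sup>+x. h x \<partial>lborel) = (\<integral>\<^sup>+y. \<integral>\<^sup>+t. h ((\<Sum>i\<in>Basis-{b}. y i *\<^sub>R i) + t *\<^sub>R b)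
    \<partial>lborel \<partial>(\<Pi>\<^sub>M i\<in>Basis-{b}. lborel))"
proof -
  interpret product_sigma_finite "\<lambda>_::'a. lborel :: real measure" by standard
  have ins: "insert b (Basis - {b}) = Basis" using b by blast
  have line: "(\<Sum>i\<in>Basis. (y(b := t)) i *\<^sub>R i) = (\<Sum>i\<in>Basis-{b}. y i *\<^sub>R i) + t *\<^sub>R b" for y t
  proof -
    have "(\<Sum>i\<in>Basis. (y(b := t)) i *\<^sub>R i) = t *\<^sub>R b + (\<Sum>i\<in>Basis-{b}. (y(b := t)) i *\<^sub>R i)"
      using b by (subst sum.remove[of _ b]) auto
    also have "(\<Sum>i\<in>Basis-{b}. (y(b := t)) i *\<^sub>R i) = (\<Sum>i\<in>Basis-{b}. y i *\<^sub>R i)"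
      by (intro sum.cong) auto
    finally show ?thesis by (simp add: add.commute)
  qed
  have "(\<integral>\<^sup>+x. h x \<partial>lborel) =
      (\<integral>\<^sup>+x. h (\<Sum>i\<in>Basis. x i *\<^sub>R i) \<partial>(\<Pi>\<^sub>M i\<in>insert b (Basis-{b}). lborel))"
    unfolding ins by (subst lborel_eq, subst nn_integral_distr) auto
  also have "\<dots> = (\<integral>\<^sup>+y. \<integral>\<^sup>+t. h (\<Sum>i\<in>Basis. (y(b := t)) i *\<^sub>R i)
      \<partial>lborel \<partial>(\<Pi>\<^sub>M i\<in>Basis-{b}. lborel))"
    by (rule product_nn_integral_insert) (auto simp: ins)
  finally show ?thesis unfolding line .
qed

text \<open>On each line in direction \<open>b\<close> the function \<open>f\<close> is constant, so
  the map is a one-dimensional affine substitution with factor \<open>a\<close>; integration over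
  the lines gives the claim.\<close>

lemma emeasure_lborel_shear:
  fixes b :: "'a::euclidean_space"
  assumes b: "b \<in> Basis" and f[measurable]: "f \<in> borel_measurable borel"
    and indep: "\<And>x t. f (x + t *\<^sub>R b) = f x"
    and a: "a \<noteq> 0" and A[measurable]: "A \<in> sets borel"
  shows "\<bar>a\<bar> * emeasure lborel ((\<lambda>x. x + ((a - 1) * (x \<bullet> b) + f x) *\<^sub>R b) -` A) = emeasure lborel A"
proof -
  let ?E = "\<lambda>x. x + ((a - 1) * (x \<bullet> b) + f x) *\<^sub>R b"
  let ?Y = "\<lambda>y. \<Sum>i\<in>Basis-{b}. y i *\<^sub>R i"
  have [measurable]: "?E -` A \<in> sets borel"
    using measurable_sets_borel[OF _ A, of ?E] by measurable
  have Yb: "?Y y \<bullet> b = 0" for y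
    using b by (auto simp: inner_sum_left inner_Basis intro!: sum.neutral)
  have E: "?E (?Y y + t *\<^sub>R b) = ?Y y + (f (?Y y) + a * t) *\<^sub>R b" for y t
    unfolding indep inner_add_left Yb using b by (simp add: algebra_simps)
  have line[measurable]: "(\<lambda>t. indicator A (?Y y + t *\<^sub>R b) :: ennreal) \<in> borel_measurable borel" for y
    by measurable
  have "emeasure lborel A = (\<integral>\<^sup>+x. indicator A x \<partial>lborel)" by simp
  also have "\<dots> = (\<integral>\<^sup>+y. \<integral>\<^sup>+t. indicator A (?Y y + t *\<^sub>R b)
      \<partial>lborel \<partial>(\<Pi>\<^sub>M i\<in>Basis-{b}. lborel))"
    by (rule nn_integral_lborel_split[OF b]) measurable
  also have "\<dots> = (\<integral>\<^sup>+y. \<bar>a\<bar> * \<integral>\<^sup>+t. indicator A (?Y y + (f (?Y y) + a * t) *\<^sub>R b)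
      \<partial>lborel \<partial>(\<Pi>\<^sub>M i\<in>Basis-{b}. lborel))"
    by (intro nn_integral_cong nn_integral_real_affine line a)
  also have "\<dots> = (\<integral>\<^sup>+y. \<bar>a\<bar> * \<integral>\<^sup>+t. indicator (?E -` A) (?Y y + t *\<^sub>R b)
      \<partial>lborel \<partial>(\<Pi>\<^sub>M i\<in>Basis-{b}. lborel))"
    unfolding E[symmetric] by (simp add: indicator_def)
  also have "\<dots> = \<bar>a\<bar> * (\<integral>\<^sup>+y. \<integral>\<^sup>+t. indicator (?E -` A) (?Y y + t *\<^sub>R b)
      \<partial>lborel \<partial>(\<Pi>\<^sub>M i\<in>Basis-{b}. lborel))"
    by (rule nn_integral_cmult) measurable
  also have "(\<integral>\<^sup>+y. \<integral>\<^sup>+t. indicator (?E -` A) (?Y y + t *\<^sub>R b)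
      \<partial>lborel \<partial>(\<Pi>\<^sub>M i\<in>Basis-{b}. lborel)) = (\<integral>\<^sup>+x. indicator (?E -` A) x \<partial>lborel)"
    by (rule nn_integral_lborel_split[OF b, symmetric]) measurable
  finally show ?thesis by simp
qed

text \<open>Affine maps whose matrix in the numbering \<open>e\<close> is triangular with positive
  diagonal \<open>a\<close>. The part \<open>f i\<close> may have a constant term, so linearity is
  demanded of \<open>f i x - f i 0\<close>.\<close>

definition triangular ::
  "nat \<Rightarrow> (nat \<Rightarrow> 'n::finite) \<Rightarrow> (nat \<Rightarrow> real) \<Rightarrow> (nat \<Rightarrow> real ^ 'n \<Rightarrow> real) \<Rightarrow> (real ^ 'n \<Rightarrow> real ^ 'n) \<Rightarrow> bool"
  where
  "triangular n e a f T \<longleftrightarrow> bij_betw e {1..n} UNIV \<and>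
    (\<forall>i\<in>{1..n}. a i > 0 \<and> linear (\<lambda>x. f i x - f i 0) \<and>
      (\<forall>x y. (\<forall>j\<in>{1..<i}. x $ e j = y $ e j) \<longrightarrow> f i x = f i y) \<and>
      (\<forall>x. T x $ e i = a i * x $ e i + f i x))"

lemma triangularD:
  assumes "triangular n e a f T" "i \<in> {1..n}"
  shows "a i > 0" "linear (\<lambda>x. f i x - f i 0)"
    "(\<And>j. j \<in> {1..<i} \<Longrightarrow> x $ e j = y $ e j) \<Longrightarrow> f i x = f i y"
    "T x $ e i = a i * x $ e i + f i x"
  using assms unfolding triangular_def by blast+

lemma index_cases:
  assumes "bij_betw e {1..n} (UNIV :: 'n set)"
  obtains i where "i \<in> {1..n}" "k = e i"
  using assms by (metis UNIV_I bij_betw_imp_surj_on imageE)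

lemma triangular_inj:
  assumes T: "triangular n e a f T"
  shows "inj T"
proof (rule injI)
  fix x y assume xy: "T x = T y"
  have bij: "bij_betw e {1..n} UNIV" using T by (simp add: triangular_def)
  have "x $ e i = y $ e i" if "i \<in> {1..n}" for i
    using that
  proof (induction i rule: less_induct)
    case (less i)
    then have "f i x = f i y" by (intro triangularD(3)[OF T]) auto
    then have "a i * x $ e i = a i * y $ e i"
      using xy triangularD(4)[OF T less.prems] by (metis add_right_cancel)
    then show ?case using triangularD(1)[OF T less.prems] by simp
  qed
  then show "x = y" by (metis index_cases[OF bij] vec_eq_iff)
qed

lemma triangular_affine:
  assumes T: "triangular n e a f T"
  shows "linear (\<lambda>x. T x - T 0)"
proof -
  have bij: "bij_betw e {1..n} UNIV" using T by (simp add: triangular_def)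
  have lin: "linear (\<lambda>x. (T x - T 0) $ k)" for k
  proof -
    obtain i where i: "i \<in> {1..n}" "k = e i" using index_cases[OF bij] by blast
    have "linear (\<lambda>x. a i *\<^sub>R (x $ e i) + (f i x - f i 0))"
      by (intro linear_compose_add linear_compose_scale_right triangularD(2)[OF T i(1)]
          bounded_linear.linear[OF bounded_linear_vec_nth])
    then show ?thesis using i by (simp add: triangularD(4)[OF T] algebra_simps)
  qed
  show ?thesis
  proof (rule linearI)
    show "T (x + y) - T 0 = (T x - T 0) + (T y - T 0)" for x y
      using linear_add[OF lin] by (simp add: vec_eq_iff)
    show "T (c *\<^sub>R x) - T 0 = c *\<^sub>R (T x - T 0)" for c x
      using linear_cmul[OF lin] by (simp add: vec_eq_iff)
  qed
qed

lemma emeasure_triangular: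
  assumes T: "triangular n e a f T" and A: "A \<in> sets borel"
  shows "(\<Prod>i=1..n. ennreal (a i)) * emeasure lborel (T -` A) = emeasure lborel A"
proof -
  have bij: "bij_betw e {1..n} UNIV" using T by (simp add: triangular_def)
  have e_eq: "e i = e j \<longleftrightarrow> i = j" if "i \<in> {1..n}" "j \<in> {1..n}" for i j
    using inj_on_eq_iff[OF bij_betw_imp_inj_on[OF bij]] that by blast
  \<comment> \<open>Interpolates between the identity at \<open>k = n\<close> and \<open>T\<close>
    at \<open>k = 0\<close> by applying \<open>T\<close> only to the coordinates after
    \<open>k\<close>. Passing from \<open>Suc k\<close> to \<open>k\<close> is one shear in
    coordinate \<open>Suc k\<close>.\<close>
  define P where "P k x = (\<chi> j. if j \<in> e ` {k<..n} then T x $ j else x $ j)" for k x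
  have P: "P k x $ e i = (if k < i then T x $ e i else x $ e i)" if "i \<in> {1..n}" for k x i
    using that e_eq by (auto simp: P_def)
  have "(\<Prod>i\<in>{k<..n}. ennreal (a i)) * emeasure lborel (P k -` A) = emeasure lborel A"
    if "k \<le> n" for k
    using that A
  proof (induction "n - k" arbitrary: k A)
    case 0
    then have "P k = id" by (auto simp: P_def vec_eq_iff)
    then show ?case using 0 by simp
  next
    case (Suc m)
    then have k: "k < n" "Suc k \<in> {1..n}" by auto
    let ?b = "axis (e (Suc k)) (1::real)"
    let ?E = "\<lambda>x. x + ((a (Suc k) - 1) * (x \<bullet> ?b) + f (Suc k) x) *\<^sub>R ?b"
    have nth_b: "?b $ e i = (if i = Suc k then 1 else 0)" if "i \<in> {1..n}" for i
      using that k e_eq by (auto simp: axis_def)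
    have indep: "f (Suc k) (x + t *\<^sub>R ?b) = f (Suc k) x" for x t
      using k nth_b by (intro triangularD(3)[OF T k(2)]) auto
    have "linear (\<lambda>x. f (Suc k) x - f (Suc k) 0)" by (rule triangularD(2)[OF T k(2)])
    then have "continuous_on UNIV (\<lambda>x. (f (Suc k) x - f (Suc k) 0) + f (Suc k) 0)"
      by (intro continuous_on_add linear_continuous_on continuous_on_const linear_conv_bounded_linear[THEN iffD1])
    then have f[measurable]: "f (Suc k) \<in> borel_measurable borel"
      by (simp add: borel_measurable_continuous_onI)
    have E_A: "?E -` A \<in> sets borel"
      using measurable_sets_borel[OF _ Suc.prems(2), of ?E] by measurable
    \<comment> \<open>The shear may come after \<open>P (Suc k)\<close>, since it reads only
      coordinates that \<open>P (Suc k)\<close> leaves unchanged.\<close>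
    have comp: "P k x = ?E (P (Suc k) x)" for x
    proof -
      have fk: "f (Suc k) (P (Suc k) x) = f (Suc k) x"
        using k by (intro triangularD(3)[OF T k(2)]) (simp add: P)
      have "P k x $ e i = ?E (P (Suc k) x) $ e i" if "i \<in> {1..n}" for i
      proof (cases "i = Suc k")
        case True
        then show ?thesis using k triangularD(4)[OF T k(2), of x]
          by (simp add: P nth_b fk inner_axis algebra_simps)
      next
        case False
        then have "k < i \<longleftrightarrow> Suc k < i" by auto
        then show ?thesis using that False by (simp add: P nth_b)
      qed
      then show ?thesis by (metis index_cases[OF bij] vec_eq_iff)
    qed
    have "{k<..n} = insert (Suc k) {Suc k<..n}" using k by auto
    then have "(\<Prod>i\<in>{k<..n}. ennreal (a i)) * emeasure lborel (P k -` A)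
        = ennreal (a (Suc k)) * ((\<Prod>i\<in>{Suc k<..n}. ennreal (a i)) * emeasure lborel (P (Suc k) -` (?E -` A)))"
      by (simp add: comp vimage_def mult.assoc)
    also have "(\<Prod>i\<in>{Suc k<..n}. ennreal (a i)) * emeasure lborel (P (Suc k) -` (?E -` A))
        = emeasure lborel (?E -` A)"
      using Suc k E_A by (intro Suc.hyps(1)) auto
    also have "ennreal (a (Suc k)) * emeasure lborel (?E -` A) = emeasure lborel A"
      using emeasure_lborel_shear[OF _ f indep _ Suc.prems(2), of "a (Suc k)"]
        triangularD(1)[OF T k(2)] by (simp add: axis_in_Basis_iff)
    finally show ?case .
  qed
  from this[of 0] have "(\<Prod>i\<in>{0<..n}. ennreal (a i)) * emeasure lborel (P 0 -` A) = emeasure lborel A"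
    by simp
  moreover have "P 0 x = T x" for x
  proof -
    have "P 0 x $ e i = T x $ e i" if "i \<in> {1..n}" for i using that by (simp add: P)
    then show ?thesis by (metis index_cases[OF bij] vec_eq_iff)
  qed
  moreover have "{0<..n} = {1..n}" by auto
  ultimately show ?thesis by (simp add: vimage_def)
qed

section \<open>Preimages of the standard simplex\<close>

lemma affine_preimage_std_simplex:
  fixes U :: "'a::euclidean_space \<Rightarrow> 'a"
  assumes lin: "linear (\<lambda>x. U x - U 0)" and inj: "inj U"
  defines "S \<equiv> U -` (convex hull (insert 0 Basis))"
  shows "int DIM('a) simplex S" and "x \<in> interior S \<Longrightarrow> U x \<in> interior (convex hull (insert 0 Basis))"
    and "interior S \<noteq> {}"
proof -
  let ?L = "\<lambda>x. U x - U 0" and ?\<Delta> = "convex hull (insert 0 Basis) :: 'a set"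
  have "inj ?L" using inj by (auto simp: inj_def)
  then obtain g where g: "linear g" "\<And>x. g (?L x) = x" "\<And>x. ?L (g x) = x"
    using linear_injective_isomorphism[OF lin] by blast
  have injg: "inj g" by (metis g(3) injI)
  \<comment> \<open>The inverse of \<open>U\<close> sends \<open>y\<close> to
    \<open>d + g y\<close>, so \<open>S\<close> is the convex hull of an affinely independent image
    of \<open>insert 0 Basis\<close>.\<close>
  define d where "d = g (- U 0)"
  have gU: "d + g (U x) = x" for x
    using g(2)[of x] linear_add[OF g(1), of "- U 0" "U x"] by (simp add: d_def)
  have Ug: "U (d + g y) = y" for y
    using g(3)[of "y - U 0"] linear_add[OF g(1), of "- U 0" y] by (simp add: d_def)
  have vim: "U -` A = (+) d ` g ` A" for A
  proof (intro set_eqI iffI)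
    fix x assume "x \<in> U -` A"
    then show "x \<in> (+) d ` g ` A" using gU[of x] by (metis imageI vimageD)
  next
    fix x assume "x \<in> (+) d ` g ` A"
    then show "x \<in> U -` A" using Ug by auto
  qed
  have "S = (+) d ` g ` ?\<Delta>" by (simp add: S_def vim)
  also have "\<dots> = convex hull ((+) d ` g ` insert 0 Basis)"
    by (simp only: convex_hull_translation convex_hull_linear_image[OF g(1)])
  finally have S: "S = convex hull ((+) d ` g ` insert 0 Basis)" .
  have "independent (g ` (Basis :: 'a set))"
    using injg by (intro linear_independent_injective_image[OF g(1) independent_Basis])
      (auto intro: inj_on_subset)
  moreover have "0 \<notin> g ` (Basis :: 'a set)"
    using injg linear_0[OF g(1)] by (metis imageE injD nonzero_Basis)
  ultimately have "\<not> affine_dependent (insert 0 (g ` (Basis :: 'a set)))"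
    by (simp add: affine_dependent_iff_dependent)
  then have "\<not> affine_dependent ((+) d ` g ` insert 0 Basis)"
    unfolding affine_dependent_translation_eq[of "insert 0 (g ` Basis)" d]
    by (simp add: linear_0[OF g(1)])
  moreover have "card ((+) d ` g ` insert 0 (Basis :: 'a set)) = Suc DIM('a)"
    by (simp add: card_image card_image[OF inj_on_subset[OF injg subset_UNIV]] del: image_insert)
  ultimately show "int DIM('a) simplex S"
    unfolding simplex_def S by (intro exI[of _ "(+) d ` g ` insert 0 Basis"]) auto
  have "interior S = (+) d ` g ` interior ?\<Delta>"
    by (simp add: S_def vim interior_translation interior_injective_linear_image[OF g(1) injg])
  then have int: "interior S = U -` interior ?\<Delta>" by (simp add: vim)
  then show "x \<in> interior S \<Longrightarrow> U x \<in> interior ?\<Delta>" by simp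
  obtain y :: 'a where "y \<in> interior ?\<Delta>" by (rule interior_std_simplex_nonempty)
  then show "interior S \<noteq> {}" unfolding int using Ug[of y] by blast
qed

text \<open>Taking successive differences along the chain is a triangular map \<open>D\<close> with
  unit diagonal in the numbering \<open>e \<circ> p\<close>. The map \<open>D \<circ> T\<close>
  carries \<open>S\<close> to the standard simplex of volume \<open>1 / fact n\<close>, so only the
  diagonal of \<open>T\<close> enters the volume.\<close>

lemma chain_simplex:
  fixes e :: "nat \<Rightarrow> 'n::finite" and c :: "nat \<Rightarrow> real ^ 'n \<Rightarrow> real"
  assumes T: "triangular n e a f T" and p: "bij_betw p {1..n} {1..n}"
    and c0: "\<And>x. c 0 x = 0" and c: "\<And>k x. k \<in> {1..n} \<Longrightarrow> c k x = T x $ e (p k)"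
  defines "S \<equiv> {x. (\<forall>k\<in>{1..n}. c (k-1) x \<le> c k x) \<and> c n x \<le> 1}"
  shows "int n simplex S"
    and "fact n * (\<Prod>i=1..n. a i) * measure lebesgue S = 1"
    and "x \<in> interior S \<Longrightarrow> k \<in> {1..n} \<Longrightarrow> c (k-1) x < c k x"
    and "x \<in> interior S \<Longrightarrow> c n x < 1"
    and "interior S \<noteq> {}"
proof -
  have bij: "bij_betw e {1..n} UNIV" using T by (simp add: triangular_def)
  have card: "CARD('n) = n" using bij_betw_same_card[OF bij] by simp
  define e' where "e' = e \<circ> p"
  have bij': "bij_betw e' {1..n} UNIV" unfolding e'_def by (rule bij_betw_trans[OF p bij])
  \<comment> \<open>The predecessor in the chain is subtracted; the first coordinate has none,
    matching \<open>c 0 x = 0\<close>.\<close>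
  define g where "g i y = (if i = (1::nat) then 0 else - (y $ e' (i - 1)))" for i and y :: "real ^ 'n"
  define D where "D y = (\<chi> j. y $ j + g (inv_into {1..n} e' j) y)" for y :: "real ^ 'n"
  have D: "D y $ e' i = y $ e' i + g i y" if "i \<in> {1..n}" for y i
    using that bij' by (simp add: D_def bij_betw_def)
  have triD: "triangular n e' (\<lambda>_. 1) g D"
    unfolding triangular_def
  proof (intro conjI ballI allI impI bij')
    fix i assume i: "i \<in> {1..n}"
    show "D x $ e' i = 1 * x $ e' i + g i x" for x using D[OF i] by simp
    have "linear (\<lambda>x::real^'n. - (x $ e' (i - 1)))"
      by (intro linear_compose_neg bounded_linear.linear[OF bounded_linear_vec_nth])
    then show "linear (\<lambda>x. g i x - g i 0)"
      by (cases "i = 1") (simp_all add: g_def module_hom_zero)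
    show "g i x = g i y" if "\<forall>j\<in>{1..<i}. x $ e' j = y $ e' j" for x y
      using that i by (cases "i = 1") (auto simp: g_def)
  qed simp
  let ?U = "D \<circ> T"
  have U: "?U x $ e' k = c k x - c (k-1) x" if k: "k \<in> {1..n}" for x k
  proof (cases "k = 1")
    case True
    then show ?thesis using D[OF k] k c c0 by (simp add: g_def e'_def)
  next
    case False
    then have "k - 1 \<in> {1..n}" using k by auto
    then show ?thesis using D[OF k] k c False by (simp add: g_def e'_def)
  qed
  \<comment> \<open>The differences telescope, so the sum condition of the standard simplex becomes
    the upper bound on \<open>c n x\<close>.\<close>
  have sumU: "(\<Sum>j\<in>UNIV. ?U x $ j) = c n x" for x
  proof -
    have "(\<Sum>j\<in>UNIV. ?U x $ j) = (\<Sum>k=1..n. ?U x $ e' k)"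
      by (rule sum.reindex_bij_betw[OF bij', symmetric])
    also have "\<dots> = (\<Sum>k=1..n. c k x - c (k-1) x)" using U by (intro sum.cong) auto
    also have "\<dots> = c n x" using c0 by (induction n) auto
    finally show ?thesis .
  qed
  have ball: "(\<forall>j. Q (?U x $ j)) \<longleftrightarrow> (\<forall>k\<in>{1..n}. Q (c k x - c (k-1) x))" for x Q
    using U by (metis index_cases[OF bij'])
  have sumB: "sum ((\<bullet>) y) Basis = (\<Sum>j\<in>UNIV. y $ j)" for y :: "real ^ 'n"
  proof -
    have "(\<Sum>b\<in>Basis. y \<bullet> b) = (\<Sum>b\<in>range (\<lambda>j. axis j 1). y \<bullet> b)"
      by (simp add: Basis_vec_def UNION_singleton_eq_range)
    also have "\<dots> = (\<Sum>j\<in>UNIV. y $ j)"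
      by (subst sum.reindex) (auto simp: inj_on_def axis_eq_axis inner_axis)
    finally show ?thesis .
  qed
  have allB: "(\<forall>b\<in>Basis. Q (y \<bullet> b)) \<longleftrightarrow> (\<forall>j. Q (y $ j))" for y :: "real ^ 'n" and Q
    by (auto simp: Basis_vec_def inner_axis)
  have S: "S = ?U -` (convex hull (insert 0 Basis))"
    unfolding S_def std_simplex sumB allB vimage_def mem_Collect_eq ball sumU by simp
  have injU: "inj ?U" using triangular_inj[OF T] triangular_inj[OF triD] by (rule inj_compose[rotated])
  have "linear (\<lambda>x. ?U x - ?U 0)"
  proof -
    let ?LD = "\<lambda>y. D y - D 0" and ?LT = "\<lambda>x. T x - T 0"
    have "?U x - ?U 0 = ?LD (?LT x)" for x
      using linear_diff[OF triangular_affine[OF triD], of "T x" "T 0"] by simp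
    then show ?thesis
      using linear_compose[OF triangular_affine[OF T] triangular_affine[OF triD]]
      by (simp add: o_def)
  qed
  note simp = affine_preimage_std_simplex[OF this injU, folded S]
  show "int n simplex S" using simp(1) card by simp
  show "interior S \<noteq> {}" by (rule simp(3))
  show "c (k-1) x < c k x" if "x \<in> interior S" "k \<in> {1..n}" for x k
    using simp(2)[OF that(1)] that(2)
    unfolding interior_std_simplex sumB allB mem_Collect_eq ball sumU by simp
  show "c n x < 1" if "x \<in> interior S" for x
    using simp(2)[OF that]
    unfolding interior_std_simplex sumB allB mem_Collect_eq ball sumU by simp
  let ?\<Delta> = "convex hull (insert 0 Basis) :: (real ^ 'n) set"
  have closed: "closed ?\<Delta>"
    by (intro compact_imp_closed finite_imp_compact_convex_hull) simp
  then have \<Delta>: "?\<Delta> \<in> sets borel" by simp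
  have D\<Delta>: "D -` ?\<Delta> \<in> sets borel"
  proof -
    have "continuous_on UNIV (\<lambda>x. (D x - D 0) + D 0)"
      using triangular_affine[OF triD]
      by (intro continuous_on_add linear_continuous_on continuous_on_const linear_conv_bounded_linear[THEN iffD1])
    then have "D \<in> borel_measurable borel" by (simp add: borel_measurable_continuous_onI)
    then show ?thesis using \<Delta> by (rule measurable_sets_borel)
  qed
  have closedS: "closed S" using simp(1) by (rule closed_simplex)
  have "S = T -` D -` ?\<Delta>" unfolding S by auto
  then have "(\<Prod>i=1..n. ennreal (a i)) * emeasure lborel S = emeasure lborel ?\<Delta>"
    using emeasure_triangular[OF T D\<Delta>] emeasure_triangular[OF triD \<Delta>] by simp
  also have "\<dots> = ennreal (1 / fact n)" using card by (simp add: emeasure_std_simplex)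
  finally have em: "(\<Prod>i=1..n. ennreal (a i)) * emeasure lborel S = ennreal (1 / fact n)" .
  have pos: "a i > 0" if "i \<in> {1..n}" for i by (rule triangularD(1)[OF T that])
  have "bounded S" using simp(1) compact_simplex compact_imp_bounded by blast
  then have fin: "emeasure lborel S < \<infinity>" by (rule emeasure_bounded_finite)
  have "(\<Prod>i=1..n. ennreal (a i)) = ennreal (\<Prod>i=1..n. a i)"
    using pos by (intro prod_ennreal) (auto intro: less_imp_le)
  moreover have nonneg: "(\<Prod>i=1..n. a i) \<ge> 0"
    using pos by (intro prod_nonneg) (auto intro: less_imp_le)
  ultimately have "ennreal ((\<Prod>i=1..n. a i) * measure lborel S) = ennreal (1 / fact n)"
    using em fin emeasure_eq_ennreal_measure[of lborel S] by (simp add: ennreal_mult)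
  then have "(\<Prod>i=1..n. a i) * measure lborel S = 1 / fact n"
    using nonneg by (subst (asm) ennreal_inj) auto
  moreover have "measure lebesgue S = measure lborel S"
    using closedS by (simp add: measure_completion)
  ultimately show "fact n * (\<Prod>i=1..n. a i) * measure lebesgue S = 1"
    by (simp add: mult.assoc)
qed

section \<open>The simplex of a forest\<close>

lemma labeled_forest_iff: "F \<in> labeled_forests n \<longleftrightarrow> labeled_forest n F"
  by (auto simp: labeled_forests_def labeled_forest_def labeled_graph_def labeled_forest_axioms_def)

text \<open>Coordinate 0 is the constant 1, so the bound on the first coordinate is the case
  \<open>i = 1\<close> of the general one.\<close>

lemma gayley_polytope_eq:
  assumes "n \<ge> 1"
  shows "gayley_polytope n \<iota> =
    {x. \<forall>i\<in>{1..n}. 0 \<le> coord \<iota> x i \<and> coord \<iota> x i \<le> 2 * coord \<iota> x (i-1)}"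
proof -
  have "{1..n} = insert 1 {2..n}" using assms by auto
  then show ?thesis by (auto simp: gayley_polytope_def coord_def)
qed

context labeled_forest
begin

section \<open>Positions, component roots and heights along the order\<close>

abbreviation "nodelist \<equiv> nfs_order n G"
abbreviation "pos \<equiv> nfs_pos n G"
abbreviation "croot \<equiv> comp_root G"
abbreviation "height \<equiv> canes_from G"

lemma order_facts: "distinct nodelist" "set nodelist = nodes" "length nodelist = Suc n"
  using distinct_visited[of n] set_visited_n length_visited_n by (auto simp: nfs_order_eq)

lemma order_in_nodes: "q \<le> n \<Longrightarrow> nodelist ! q \<in> nodes"
  using nth_mem[of q nodelist] order_facts by simp

lemma order_0: "nodelist ! 0 = n + 1"
proof -
  obtain l where "visited n = visited 0 @ l" using visited_prefix[of 0 n] by auto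
  then show ?thesis by (simp add: nfs_order_eq)
qed

lemma root_max: "croot (n+1) = n+1"
  using comp_root_current[of 0] by simp

lemma pos_order: "q \<le> n \<Longrightarrow> pos (nodelist ! q) = q"
  unfolding nfs_pos_def
  using order_facts by (subst takeWhile_eq_take_P_nth[of q]) (auto simp: nth_eq_iff_index_eq)

lemma order_pos:
  assumes "v \<in> nodes" shows "nodelist ! pos v = v" "pos v \<le> n"
proof -
  obtain q where "q \<le> n" "v = nodelist ! q"
    using assms order_facts by (metis in_set_conv_nth less_Suc_eq_le)
  then show "nodelist ! pos v = v" "pos v \<le> n" by (simp_all add: pos_order)
qed

lemma pos_max: "pos (n+1) = 0"
  using pos_order[of 0] order_0 by simp

lemma bij_pos: "bij_betw pos {1..n} {1..n}"
proof (rule bij_betw_byWitness[where f' = "\<lambda>q. nodelist ! q"])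
  have "pos v \<noteq> 0" if "v \<in> {1..n}" for v
    using order_pos(1)[of v] order_0 that by (cases "pos v") auto
  then show "pos ` {1..n} \<subseteq> {1..n}" using order_pos(2) by (auto simp: Suc_le_eq)
  have "nodelist ! q \<noteq> n + 1" if "q \<in> {1..n}" for q
    using pos_order[of q] pos_max that by auto
  then show "(\<lambda>q. nodelist ! q) ` {1..n} \<subseteq> {1..n}"
    using order_in_nodes by (force simp: le_Suc_eq)
qed (auto simp: order_pos pos_order)

lemma root_in_nodes: "v \<in> nodes \<Longrightarrow> croot v \<in> nodes"
  using comp_root_in_component[OF graph] graph_component_subset_nodes[OF graph] by blast

lemma root_root: "v \<in> nodes \<Longrightarrow> croot (croot v) = croot v"
  using comp_root_eq[OF comp_root_in_component[OF graph]] .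

text \<open>The index \<open>l\<close> in the formula for \<open>c(k,F)\<close>, but as a function
  of the position, because it is in the order of positions that the coordinates form a triangular
  system.\<close>

definition "root_pos q = pos (croot (nodelist ! q))"

lemma root_pos_0: "root_pos 0 = 0"
  using pos_max root_max order_0 by (simp add: root_pos_def)

lemma order_root_pos: "q \<le> n \<Longrightarrow> nodelist ! root_pos q = croot (nodelist ! q)"
  unfolding root_pos_def by (intro order_pos root_in_nodes order_in_nodes)

lemma root_pos_Suc:
  assumes "0 < q" "q \<le> n"
  shows "root_pos q = (if croot (nodelist ! q) = nodelist ! q then q else root_pos (q - 1))"
proof -
  have q: "pos (nodelist ! q) = q" using assms by (intro pos_order)
  show ?thesis using assms by (cases rule: nfs_order_cases) (auto simp: root_pos_def q)
qed

lemma root_pos_le: "q \<le> n \<Longrightarrow> root_pos q \<le> q"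
proof (induction q)
  case (Suc q)
  then show ?case using root_pos_Suc[of "Suc q"] by auto
qed (simp add: root_pos_0)

lemma root_pos_eq_iff: "q \<le> n \<Longrightarrow> root_pos q = q \<longleftrightarrow> croot (nodelist ! q) = nodelist ! q"
  using order_root_pos[of q] by (auto simp: root_pos_def pos_order)

lemma height_root: "v \<in> nodes \<Longrightarrow> croot v = v \<Longrightarrow> height v = 0"
  using canes_no_parent[of v] root_no_parent[of v] by (simp add: canes_from_eq)

lemma node_coord_order:
  assumes "q \<le> n"
  shows "node_coord n \<iota> G x (nodelist ! q) =
    (if root_pos q = q then coord \<iota> x q
     else coord \<iota> x q / 2 ^ height (nodelist ! q) - coord \<iota> x (root_pos q))"
  using assms root_pos_eq_iff[OF assms]
  by (auto simp: node_coord_def Let_def pos_order root_pos_def)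

lemma node_coord_max: "node_coord n \<iota> G x (n+1) = 1"
  using node_coord_order[of 0] order_0 root_pos_0 by (simp add: coord_def)

text \<open>Position 0 may be left out since the node \<open>n + 1\<close> there is a root and has
  height 0.\<close>

lemma sum_height: "(\<Sum>i=1..n. height (nodelist ! i)) = \<alpha> G"
proof -
  have "\<alpha> G = (\<Sum>v\<in>nodes. height v)" by (rule cane_number_eq)
  also have "\<dots> = (\<Sum>i\<le>n. height (nodelist ! i))"
  proof (rule sum.reindex_bij_betw[symmetric])
    show "bij_betw ((!) nodelist) {..n} nodes"
      using bij_betw_nth[of nodelist "{..n}" nodes] order_facts by (auto simp: lessThan_Suc_atMost)
  qed
  also have "{..n} = insert 0 {1..n}" by auto
  finally show ?thesis using height_root[of "n+1"] root_max order_0 by simp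
qed

text \<open>Node \<open>n + 1\<close> is the root at position 0, so its coordinate is the constant 1
  and closes the chain as an upper bound. With 0 put in front, this is the form that
  \<open>chain_simplex\<close> treats.\<close>

lemma forest_simplex_eq:
  fixes \<iota> :: "nat \<Rightarrow> 'n::finite"
  assumes "n \<ge> 1"
  defines "c \<equiv> \<lambda>k x. if k = 0 then 0 else node_coord n \<iota> G x k"
  shows "forest_simplex n \<iota> G = {x. (\<forall>k\<in>{1..n}. c (k-1) x \<le> c k x) \<and> c n x \<le> 1}"
proof -
  have chain: "(0 \<le> c 1 x \<and> (\<forall>k\<in>{1..n}. c k x \<le> c (k+1) x)) \<longleftrightarrow>
      (\<forall>k\<in>{1..n}. c (k-1) x \<le> c k x) \<and> c n x \<le> 1" (is "?l \<longleftrightarrow> ?r") for x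
  proof
    assume l: ?l
    have "c (k-1) x \<le> c k x" if "k \<in> {1..n}" for k
    proof (cases "k = 1")
      case False
      then have "k - 1 \<in> {1..n}" "k - 1 + 1 = k" using that by auto
      then show ?thesis using l by metis
    qed (use l c_def in simp)
    moreover have "c n x \<le> 1"
      using l assms(1) node_coord_max[of \<iota> x] bspec[of "{1..n}" "\<lambda>k. c k x \<le> c (k+1) x" n]
      by (auto simp: c_def)
    ultimately show ?r by blast
  next
    assume r: ?r
    have "c k x \<le> c (k+1) x" if "k \<in> {1..n}" for k
    proof (cases "k = n")
      case True
      then show ?thesis using r assms(1) node_coord_max[of \<iota> x] by (simp add: c_def)
    next
      case False
      then show ?thesis using r that bspec[of "{1..n}" "\<lambda>k. c (k-1) x \<le> c k x" "k + 1"] by auto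
    qed
    moreover have "0 \<le> c 1 x"
      using r assms(1) bspec[of "{1..n}" "\<lambda>k. c (k-1) x \<le> c k x" 1] by (auto simp: c_def)
    ultimately show ?l by blast
  qed
  have "x \<in> forest_simplex n \<iota> G \<longleftrightarrow> 0 \<le> c 1 x \<and> (\<forall>k\<in>{1..n}. c k x \<le> c (k+1) x)" for x
    using node_coord_max[of \<iota> x] by (auto simp: forest_simplex_def c_def)
  then show ?thesis unfolding chain by blast
qed

lemma coord_linear: "linear (\<lambda>x. coord \<iota> x i - coord \<iota> 0 i)"
proof (cases "i = 0")
  case True
  then show ?thesis by (simp add: coord_def module_hom_zero)
next
  case False
  then show ?thesis
    by (simp add: coord_def bounded_linear.linear[OF bounded_linear_vec_nth])
qed

text \<open>The coordinate of the node at position \<open>i\<close> involves \<open>x\<close> only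
  at \<open>i\<close> and at the position of its root, which comes earlier. Roots have height 0, so
  their diagonal entry has the same form.\<close>

lemma triangular_node_coord:
  assumes \<iota>: "bij_betw \<iota> {1..n} UNIV"
  shows "triangular n \<iota> (\<lambda>i. 1 / 2 ^ height (nodelist ! i))
    (\<lambda>i x. if root_pos i = i then 0 else - coord \<iota> x (root_pos i))
    (\<lambda>x. \<chi> j. node_coord n \<iota> G x (nodelist ! inv_into {1..n} \<iota> j))"
  unfolding triangular_def
proof (intro conjI ballI allI impI \<iota>)
  fix i assume i: "i \<in> {1..n}"
  have inv: "inv_into {1..n} \<iota> (\<iota> i) = i" using \<iota> i by (simp add: bij_betw_def)
  show "(\<chi> j. node_coord n \<iota> G x (nodelist ! inv_into {1..n} \<iota> j)) $ \<iota> i =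
      1 / 2 ^ height (nodelist ! i) * x $ \<iota> i + (if root_pos i = i then 0 else - coord \<iota> x (root_pos i))"
    for x
    using i node_coord_order[of i \<iota> x] height_root[OF order_in_nodes[of i]] root_pos_eq_iff[of i]
    unfolding vec_lambda_beta inv by (auto simp: coord_def)
  have "linear (\<lambda>x. - (coord \<iota> x r - coord \<iota> 0 r))" for r
    by (intro linear_compose_neg coord_linear)
  then show "linear (\<lambda>x. (if root_pos i = i then 0 else - coord \<iota> x (root_pos i)) -
      (if root_pos i = i then 0 else - coord \<iota> 0 (root_pos i)))"
    by (simp add: module_hom_zero)
  show "(if root_pos i = i then 0 else - coord \<iota> x (root_pos i)) =
      (if root_pos i = i then 0 else - coord \<iota> y (root_pos i))"
    if "\<forall>j\<in>{1..<i}. x $ \<iota> j = y $ \<iota> j" for x y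
    using that i root_pos_le[of i] by (auto simp: coord_def)
qed simp

lemma forest_simplex_facts:
  fixes \<iota> :: "nat \<Rightarrow> 'n::finite"
  assumes n: "n \<ge> 1" and \<iota>: "bij_betw \<iota> {1..n} UNIV"
  shows "int n simplex forest_simplex n \<iota> G"
    and "fact n * measure lebesgue (forest_simplex n \<iota> G) = 2 ^ \<alpha> G"
    and "interior (forest_simplex n \<iota> G) \<noteq> {}"
    and "x \<in> interior (forest_simplex n \<iota> G) \<Longrightarrow> 0 < node_coord n \<iota> G x 1"
    and "x \<in> interior (forest_simplex n \<iota> G) \<Longrightarrow> k \<in> {1..n} \<Longrightarrow>
      node_coord n \<iota> G x k < node_coord n \<iota> G x (k+1)"
proof -
  let ?c = "\<lambda>k x. if k = 0 then 0 else node_coord n \<iota> G x k"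
  have c: "?c k x = (\<chi> j. node_coord n \<iota> G x (nodelist ! inv_into {1..n} \<iota> j)) $ \<iota> (pos k)"
    if "k \<in> {1..n}" for k x
  proof -
    have "pos k \<in> {1..n}" using bij_betwE[OF bij_pos] that by blast
    then have "inv_into {1..n} \<iota> (\<iota> (pos k)) = pos k" using \<iota> by (simp add: bij_betw_def)
    then show ?thesis using order_pos(1)[of k] that by simp
  qed
  \<comment> \<open>\<open>\<iota>\<close> numbers the coordinates by position while the chain runs
    through the labels, so the permutation needed is \<open>pos\<close>.\<close>
  note chain = chain_simplex[OF triangular_node_coord[OF \<iota>] bij_pos, of ?c, OF _ c,
      folded forest_simplex_eq[OF n, of \<iota>], simplified]
  show "int n simplex forest_simplex n \<iota> G" "interior (forest_simplex n \<iota> G) \<noteq> {}"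
    using chain by auto
  have "(\<Prod>i=1..n. 1 / 2 ^ height (nodelist ! i)) = (1 / 2 ^ \<alpha> G :: real)"
    unfolding sum_height[symmetric] by (simp only: prod_dividef power_sum prod.neutral_const)
  then have "fact n * (1 / 2 ^ \<alpha> G) * measure lebesgue (forest_simplex n \<iota> G) = 1"
    using chain(2) by (simp only: One_nat_def)
  then show "fact n * measure lebesgue (forest_simplex n \<iota> G) = 2 ^ \<alpha> G"
    by (simp add: field_simps)
  assume x: "x \<in> interior (forest_simplex n \<iota> G)"
  show "0 < node_coord n \<iota> G x 1" using chain(3)[OF x, of 1] n by auto
  show "node_coord n \<iota> G x k < node_coord n \<iota> G x (k+1)" if "k \<in> {1..n}"
    using chain(3)[OF x, of "k+1"] chain(4)[OF x] node_coord_max[of \<iota> x] that by (cases "k = n") auto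
qed

section \<open>Inequalities on a simplex and its containment in the Gayley polytope\<close>

lemma forest_simplex_mono:
  assumes x: "x \<in> forest_simplex n \<iota> G" and k: "1 \<le> j" "j \<le> k" "k \<le> n+1"
  shows "0 \<le> node_coord n \<iota> G x j" "node_coord n \<iota> G x j \<le> node_coord n \<iota> G x k"
proof -
  have le_Suc: "node_coord n \<iota> G x i \<le> node_coord n \<iota> G x (Suc i)" if "1 \<le> i" "i \<le> n" for i
    using x that by (auto simp: forest_simplex_def)
  have mono: "i \<le> k \<Longrightarrow> 1 \<le> i \<Longrightarrow> k \<le> n+1 \<Longrightarrow> node_coord n \<iota> G x i \<le> node_coord n \<iota> G x k" for i k
  proof (induction k rule: dec_induct)
    case (step k)
    then show ?case using le_Suc[of k] by simp
  qed simp
  show "node_coord n \<iota> G x j \<le> node_coord n \<iota> G x k" using mono[of j k] k by simp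
  have "0 \<le> node_coord n \<iota> G x 1" using x by (simp add: forest_simplex_def)
  then show "0 \<le> node_coord n \<iota> G x j" using mono[of 1 j] k by simp
qed

lemma forest_simplex_strict_mono:
  fixes \<iota> :: "nat \<Rightarrow> 'n::finite"
  assumes n: "n \<ge> 1" and \<iota>: "bij_betw \<iota> {1..n} UNIV" and x: "x \<in> interior (forest_simplex n \<iota> G)"
  shows "j \<in> nodes \<Longrightarrow> 0 < node_coord n \<iota> G x j"
    and "j \<in> nodes \<Longrightarrow> k \<in> nodes \<Longrightarrow> node_coord n \<iota> G x j < node_coord n \<iota> G x k \<longleftrightarrow> j < k"
proof -
  note facts = forest_simplex_facts(4,5)[OF n \<iota> x]
  have step: "node_coord n \<iota> G x i < node_coord n \<iota> G x (Suc i)" if "1 \<le> i" "i \<le> n" for i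
    using facts(2)[of i] that by simp
  have mono: "i < k \<Longrightarrow> 1 \<le> i \<Longrightarrow> k \<le> n+1 \<Longrightarrow> node_coord n \<iota> G x i < node_coord n \<iota> G x k" for i k
  proof (induction k)
    case (Suc k)
    then show ?case using step[of k] by (cases "i = k") force+
  qed simp
  show "0 < node_coord n \<iota> G x j" if "j \<in> nodes"
    using mono[of 1 j] facts(1) that by (cases "j = 1") auto
  show "node_coord n \<iota> G x j < node_coord n \<iota> G x k \<longleftrightarrow> j < k" if "j \<in> nodes" "k \<in> nodes"
    using mono[of j k] mono[of k j] that by (cases j k rule: linorder_cases) auto
qed

text \<open>A component root has the largest label of its component, so
  \<open>0 \<le> c(v) \<le> c(r)\<close> for a node \<open>v\<close> with root \<open>r\<close>;
  multiplied out, this confines the coordinate to a factor of 2 fixed by the height.\<close>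

lemma forest_simplex_coord_bounds:
  assumes x: "x \<in> forest_simplex n \<iota> G" and q: "q \<le> n"
  shows "0 \<le> coord \<iota> x (root_pos q)"
    and "2 ^ height (nodelist ! q) * coord \<iota> x (root_pos q) \<le> coord \<iota> x q"
    and "coord \<iota> x q \<le> 2 * 2 ^ height (nodelist ! q) * coord \<iota> x (root_pos q)"
proof -
  let ?v = "nodelist ! q" and ?r = "root_pos q"
  have v: "?v \<in> nodes" by (rule order_in_nodes[OF q])
  have r: "?r \<le> n" using root_pos_le q order_trans by blast
  have "root_pos ?r = ?r"
    using root_pos_eq_iff[OF r] order_root_pos[OF q] root_root[OF v] by simp
  then have cr: "node_coord n \<iota> G x (croot ?v) = coord \<iota> x ?r"
    using node_coord_order[OF r] order_root_pos[OF q] by simp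
  show pos: "0 \<le> coord \<iota> x ?r"
    using forest_simplex_mono(1)[OF x, of "croot ?v" "croot ?v"] root_in_nodes[OF v] cr by simp
  have lower: "0 \<le> node_coord n \<iota> G x ?v"
    using forest_simplex_mono(1)[OF x, of ?v ?v] v by simp
  have upper: "node_coord n \<iota> G x ?v \<le> coord \<iota> x ?r"
    using forest_simplex_mono(2)[OF x, of ?v "croot ?v"] le_comp_root[OF graph v]
      root_in_nodes[OF v] v cr by simp
  have "2 ^ height ?v * coord \<iota> x ?r \<le> coord \<iota> x q \<and> coord \<iota> x q \<le> 2 * 2 ^ height ?v * coord \<iota> x ?r"
  proof (cases "?r = q")
    case True
    then show ?thesis using root_pos_eq_iff[OF q] height_root[OF v] pos by simp
  next
    case False
    then show ?thesis using lower upper node_coord_order[OF q, of \<iota> x] by (simp add: field_simps)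
  qed
  then show "2 ^ height ?v * coord \<iota> x ?r \<le> coord \<iota> x q"
    "coord \<iota> x q \<le> 2 * 2 ^ height ?v * coord \<iota> x ?r" by auto
qed

text \<open>A new root has a smaller label than the root before it, so its coordinate is at most
  that root's and hence at most the preceding one. A first child is no higher than its predecessor,
  so the bounds by powers of 2 suffice. A sibling is one higher and has a smaller label, so the
  inequality between the two node coordinates is exactly the doubling bound.\<close>

lemma forest_simplex_subset:
  assumes n: "n \<ge> 1"
  shows "forest_simplex n \<iota> G \<subseteq> gayley_polytope n \<iota>"
proof
  fix x assume x: "x \<in> forest_simplex n \<iota> G"
  have "0 \<le> coord \<iota> x q \<and> coord \<iota> x q \<le> 2 * coord \<iota> x (q-1)" if "q \<in> {1..n}" for q
  proof -
    have q: "0 < q" "q \<le> n" "q - 1 \<le> n" using that by auto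
    let ?v = "nodelist ! q" and ?u = "nodelist ! (q-1)"
    let ?r = "coord \<iota> x (root_pos q)" and ?s = "coord \<iota> x (root_pos (q - 1))"
    note v = forest_simplex_coord_bounds[OF x q(2)] and u = forest_simplex_coord_bounds[OF x q(3)]
    have nonneg: "0 \<le> coord \<iota> x q" using v by (meson mult_nonneg_nonneg order_trans zero_le_numeral zero_le_power)
    have su: "?s \<le> coord \<iota> x (q - 1)"
      using u(1,2) mult_right_mono[of 1 "2 ^ height ?u" ?s] by simp
    have "coord \<iota> x q \<le> 2 * coord \<iota> x (q-1)"
      using q(1,2)
    proof (cases rule: nfs_order_cases)
      case root
      have "root_pos q = q" using root root_pos_eq_iff q by simp
      moreover have "root_pos (root_pos (q-1)) = root_pos (q-1)"
        using root_pos_le[OF q(3)] q order_root_pos[OF q(3)] root_root[OF order_in_nodes[OF q(3)]]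
        by (simp add: root_pos_eq_iff)
      ultimately have "node_coord n \<iota> G x ?v = coord \<iota> x q" "node_coord n \<iota> G x (croot ?u) = ?s"
        using node_coord_order[of q \<iota> x] node_coord_order[of "root_pos (q-1)" \<iota> x]
          root_pos_le[OF q(3)] q order_root_pos[OF q(3)] by simp_all
      then have "coord \<iota> x q \<le> ?s"
        using forest_simplex_mono(2)[OF x, of ?v "croot ?u"] root order_in_nodes[OF q(2)]
          root_in_nodes[OF order_in_nodes[OF q(3)]] by simp
      then show ?thesis using su u(1) by simp
    next
      case (first_child p)
      have r: "root_pos q = root_pos (q-1)" using first_child q by (simp add: root_pos_Suc)
      \<comment> \<open>The predecessor is the parent itself or lies between parent and child in the
        order.\<close>
      have "height ?v \<le> height ?u"
      proof (cases "p = q - 1")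
        case False
        then have "p < q - 1" using first_child(3) by linarith
        then show ?thesis using first_child(3) first_child(6)[of "q-1"] q by simp
      qed (use first_child(5) in simp)
      then have "2 ^ height ?v * ?r \<le> 2 ^ height ?u * ?r"
        using v(1) by (intro mult_right_mono) auto
      then show ?thesis using v(3) u(2) r by simp
    next
      case (sibling p)
      have r: "root_pos q = root_pos (q-1)" "root_pos q \<noteq> q" "root_pos (q-1) \<noteq> q-1"
        using root_pos_eq_iff[OF q(2)] root_pos_eq_iff[OF q(3)] root_pos_Suc[OF q(1,2)] sibling
        by auto
      then have "node_coord n \<iota> G x ?v \<le> node_coord n \<iota> G x ?u"
        using forest_simplex_mono(2)[OF x, of ?v ?u] sibling(6) order_in_nodes[OF q(2)]
          order_in_nodes[OF q(3)] by simp
      then show ?thesis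
        using node_coord_order[OF q(2), of \<iota> x] node_coord_order[OF q(3), of \<iota> x] r sibling(7)
        by (simp add: field_simps)
    qed
    then show ?thesis using nonneg by simp
  qed
  then show "x \<in> gayley_polytope n \<iota>" unfolding gayley_polytope_eq[OF n] by blast
qed

section \<open>Recovering a forest from an interior point\<close>

lemma interior_coord_bounds:
  fixes \<iota> :: "nat \<Rightarrow> 'n::finite"
  assumes n: "n \<ge> 1" and \<iota>: "bij_betw \<iota> {1..n} UNIV" and x: "x \<in> interior (forest_simplex n \<iota> G)"
    and q: "q \<le> n" "root_pos q \<noteq> q"
  shows "2 ^ height (nodelist ! q) * coord \<iota> x (root_pos q) < coord \<iota> x q"
    and "coord \<iota> x q < 2 ^ Suc (height (nodelist ! q)) * coord \<iota> x (root_pos q)"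
    and "0 < coord \<iota> x (root_pos q)"
proof -
  let ?v = "nodelist ! q" and ?r = "root_pos q"
  note mono = forest_simplex_strict_mono[OF n \<iota> x]
  have v: "?v \<in> nodes" by (rule order_in_nodes[OF q(1)])
  have r: "?r \<le> n" using root_pos_le q order_trans by blast
  have "root_pos ?r = ?r"
    using root_pos_eq_iff[OF r] order_root_pos[OF q(1)] root_root[OF v] by simp
  then have cr: "node_coord n \<iota> G x (croot ?v) = coord \<iota> x ?r"
    using node_coord_order[OF r] order_root_pos[OF q(1)] by simp
  show "0 < coord \<iota> x ?r" using mono(1)[OF root_in_nodes[OF v]] cr by simp
  have lower: "0 < node_coord n \<iota> G x ?v" by (rule mono(1)[OF v])
  have "?v < croot ?v" using le_comp_root[OF graph v] q root_pos_eq_iff[OF q(1)] by simp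
  then have upper: "node_coord n \<iota> G x ?v < coord \<iota> x ?r"
    using mono(2)[OF v root_in_nodes[OF v]] cr by simp
  show "2 ^ height ?v * coord \<iota> x ?r < coord \<iota> x q"
    "coord \<iota> x q < 2 ^ Suc (height ?v) * coord \<iota> x ?r"
    using lower upper node_coord_order[OF q(1), of \<iota> x] q(2) by (simp_all add: field_simps)
qed

text \<open>At a new root, \<open>x\<close> drops below its value at the previous root; elsewhere it
  exceeds its value at the root of the component. So the roots can be read off from left to
  right.\<close>

lemma interior_root_pos:
  fixes \<iota> :: "nat \<Rightarrow> 'n::finite"
  assumes n: "n \<ge> 1" and \<iota>: "bij_betw \<iota> {1..n} UNIV" and x: "x \<in> interior (forest_simplex n \<iota> G)"
    and q: "0 < q" "q \<le> n"
  shows "root_pos q = (if coord \<iota> x q < coord \<iota> x (root_pos (q-1)) then q else root_pos (q-1))"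
proof (cases "root_pos q = q")
  case True
  have q': "q - 1 \<le> n" using q by simp
  let ?u = "nodelist ! (q-1)" and ?r = "root_pos (q-1)"
  have r: "?r \<le> n" using root_pos_le[OF q'] q by simp
  have v: "croot (nodelist ! q) = nodelist ! q" using True root_pos_eq_iff[OF q(2)] by simp
  have "root_pos ?r = ?r"
    using root_pos_eq_iff[OF r] order_root_pos[OF q'] root_root[OF order_in_nodes[OF q']] by simp
  then have cr: "node_coord n \<iota> G x (croot ?u) = coord \<iota> x ?r"
    using node_coord_order[OF r] order_root_pos[OF q'] by simp
  have "nodelist ! q < croot ?u"
    using q v by (cases rule: nfs_order_cases) auto
  then have "node_coord n \<iota> G x (nodelist ! q) < node_coord n \<iota> G x (croot ?u)"
    using forest_simplex_strict_mono(2)[OF n \<iota> x] order_in_nodes[OF q(2)]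
      root_in_nodes[OF order_in_nodes[OF q']] by blast
  then show ?thesis using True cr node_coord_order[OF q(2), of \<iota> x] by simp
next
  case False
  then have r: "root_pos q = root_pos (q-1)" using q by (metis root_pos_Suc)
  note bounds = interior_coord_bounds[OF n \<iota> x q(2) False]
  have "coord \<iota> x (root_pos q) \<le> 2 ^ height (nodelist ! q) * coord \<iota> x (root_pos q)"
    using bounds(3) mult_right_mono[of 1 "2 ^ height (nodelist ! q)" "coord \<iota> x (root_pos q)"] by simp
  then show ?thesis using bounds(1) r by simp
qed

text \<open>In the interior the node coordinates are strictly ordered like the labels, so a label is
  the rank of its coordinate. The negated inequality counts the node itself as well.\<close>

lemma interior_label:
  fixes \<iota> :: "nat \<Rightarrow> 'n::finite"
  assumes n: "n \<ge> 1" and \<iota>: "bij_betw \<iota> {1..n} UNIV" and x: "x \<in> interior (forest_simplex n \<iota> G)"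
    and q: "q \<le> n"
  shows "nodelist ! q =
    card {p \<in> {..n}. \<not> node_coord n \<iota> G x (nodelist ! q) < node_coord n \<iota> G x (nodelist ! p)}"
proof -
  have "{p \<in> {..n}. \<not> node_coord n \<iota> G x (nodelist ! q) < node_coord n \<iota> G x (nodelist ! p)}
      = {p \<in> {..n}. nodelist ! p \<le> nodelist ! q}"
    using forest_simplex_strict_mono(2)[OF n \<iota> x order_in_nodes[OF q] order_in_nodes] by auto
  also have "bij_betw ((!) nodelist) {p \<in> {..n}. nodelist ! p \<le> nodelist ! q} {1..nodelist ! q}"
  proof (rule bij_betw_byWitness[where f' = pos])
    show "(!) nodelist ` {p \<in> {..n}. nodelist ! p \<le> nodelist ! q} \<subseteq> {1..nodelist ! q}"
      using order_in_nodes by auto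
    show "pos ` {1..nodelist ! q} \<subseteq> {p \<in> {..n}. nodelist ! p \<le> nodelist ! q}"
      using order_in_nodes[OF q] order_pos by auto
    show "\<forall>v\<in>{1..nodelist ! q}. nodelist ! pos v = v"
      using order_in_nodes[OF q] by (auto simp: order_pos)
  qed (auto simp: pos_order)
  ultimately show ?thesis using bij_betw_same_card by fastforce
qed

end

text \<open>From the preceding position the height rises by one at a later sibling and does not rise
  at a first child, so both forests are in the same case. A first child hangs on the last earlier
  position of no greater height, a sibling on the parent of its predecessor, which is known by
  induction. Equality of the forests follows by symmetry.\<close>

lemma forest_subset:
  assumes F: "labeled_forest n F" and F': "labeled_forest n F'"
    and order: "nfs_order n F = nfs_order n F'"
    and heights: "\<And>q. q \<le> n \<Longrightarrow> canes_from F (nfs_order n F ! q) = canes_from F' (nfs_order n F ! q)"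
    and roots: "\<And>q. q \<le> n \<Longrightarrow> comp_root F (nfs_order n F ! q) = nfs_order n F ! q
      \<longleftrightarrow> comp_root F' (nfs_order n F ! q) = nfs_order n F ! q"
  shows "F \<subseteq> F'"
proof
  interpret F: labeled_forest n F by (rule F)
  interpret F': labeled_forest n F' by (rule F')
  let ?xs = "nfs_order n F"
  have parent: "F'.tree_parent p (?xs ! q)" if "q \<le> n" "F.tree_parent p (?xs ! q)" for p q
    using that
  proof (induction q arbitrary: p rule: less_induct)
    case (less q)
    have nonroot: "comp_root F (?xs ! q) \<noteq> ?xs ! q"
      using less.prems F.root_no_parent[OF F.order_in_nodes] by metis
    then have q: "0 < q" using F.order_0 F.root_max by (cases q) auto
    have q1: "q - 1 \<le> n" using less.prems by simp
    show ?case
      using q less.prems(1)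
    proof (cases rule: F.nfs_order_cases)
      case root
      then show ?thesis using nonroot by simp
    next
      case (first_child i)
      then have p: "p = ?xs ! i" using less.prems F.tree_parent_unique by blast
      have le: "canes_from F (?xs ! q) \<le> canes_from F (?xs ! (q-1))"
      proof (cases "i = q - 1")
        case False
        then have "i < q - 1" using first_child(3) by linarith
        then show ?thesis using first_child(3) first_child(6)[of "q-1"] q by simp
      qed (use first_child(5) in simp)
      show ?thesis
        using q less.prems(1)
      proof (cases rule: F'.nfs_order_cases)
        case root
        then show ?thesis using nonroot roots[OF less.prems(1)] order by simp
      next
        case j: (first_child j)
        have hts: "canes_from F (?xs ! j) = canes_from F (?xs ! q)"
          using j(3,5) heights less.prems(1) order by simp
        have between: "canes_from F (?xs ! q) < canes_from F (?xs ! r)" if "j < r" "r < q" for r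
          using j(6)[of r] that heights less.prems(1) order by simp
        \<comment> \<open>Both positions have the height of the node at \<open>q\<close> and only
          higher ones between them and \<open>q\<close>, so neither can precede the other.\<close>
        have "i = j"
          using first_child(3,5) first_child(6)[of j] between[of i] hts j(3)
          by (cases i j rule: linorder_cases) auto
        then show ?thesis using j(4) p order by simp
      next
        case (sibling s)
        then show ?thesis using le heights[OF less.prems(1)] heights[OF q1] order by simp
      qed
    next
      case (sibling s)
      then have "p = s" using less.prems F.tree_parent_unique by blast
      show ?thesis
        using q less.prems(1)
      proof (cases rule: F'.nfs_order_cases)
        case root
        then show ?thesis using nonroot roots[OF less.prems(1)] order by simp
      next
        case (first_child j)
        have "canes_from F' (?xs ! q) \<le> canes_from F' (?xs ! (q-1))"
        proof (cases "j = q - 1")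
          case False
          then have "j < q - 1" using first_child(3) by linarith
          then show ?thesis using first_child(3) first_child(6)[of "q-1"] q order by simp
        qed (use first_child(5) order in simp)
        then show ?thesis using sibling(7) heights[OF less.prems(1)] heights[OF q1] by simp
      next
        case s': (sibling s')
        have "F'.tree_parent s (?xs ! (q-1))"
          using less.IH[of "q-1" s] sibling(4) q less.prems(1) by simp
        then have "s = s'" using s'(4) F'.tree_parent_unique order by metis
        then show ?thesis using s'(5) \<open>p = s\<close> order by simp
      qed
    qed
  qed
  fix e assume e: "e \<in> F"
  then obtain a b where ab: "e = {a, b}" "a \<in> {1..n+1}" "b \<in> {1..n+1}"
    by (rule labeled_graph_edgeE[OF F.graph])
  then have "F.tree_parent a b \<or> F.tree_parent b a" using e F.edge_tree_parent by simp
  moreover have "F'.tree_parent p v" if "F.tree_parent p v" "v \<in> {1..n+1}" for p v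
    using parent[of "F.pos v" p] that F.order_pos[of v] by simp
  ultimately show "e \<in> F'" using ab F'.edge_tree_parent by blast
qed

lemma interior_forest_unique:
  fixes \<iota> :: "nat \<Rightarrow> 'n::finite"
  assumes n: "n \<ge> 1" and \<iota>: "bij_betw \<iota> {1..n} UNIV"
    and F: "labeled_forest n F" and F': "labeled_forest n F'"
    and x: "x \<in> interior (forest_simplex n \<iota> F)" and x': "x \<in> interior (forest_simplex n \<iota> F')"
  shows "F = F'"
proof -
  interpret F: labeled_forest n F by (rule F)
  interpret F': labeled_forest n F' by (rule F')
  have rp: "F.root_pos q = F'.root_pos q" if "q \<le> n" for q
    using that
  proof (induction q)
    case (Suc q)
    then show ?case
      using F.interior_root_pos[OF n \<iota> x, of "Suc q"] F'.interior_root_pos[OF n \<iota> x', of "Suc q"]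
      by simp
  qed (simp add: F.root_pos_0 F'.root_pos_0)
  have ht: "canes_from F (nfs_order n F ! q) = canes_from F' (nfs_order n F' ! q)" if q: "q \<le> n" for q
  proof (cases "F.root_pos q = q")
    case True
    then have "comp_root F (nfs_order n F ! q) = nfs_order n F ! q"
      "comp_root F' (nfs_order n F' ! q) = nfs_order n F' ! q"
      using rp[OF q] F.root_pos_eq_iff[OF q] F'.root_pos_eq_iff[OF q] by simp_all
    then show ?thesis
      using F.height_root[OF F.order_in_nodes[OF q]] F'.height_root[OF F'.order_in_nodes[OF q]] by simp
  next
    case False
    \<comment> \<open>Applied in both directions to the bounds at one position, this shows that the
      quotient \<open>d / c\<close> determines the height.\<close>
    have *: "h < Suc h'" if "2 ^ h * c < d" "d < 2 ^ Suc h' * c" "0 < c" for h h' :: nat and c d :: real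
    proof -
      have "2 ^ h * c < 2 ^ Suc h' * c" using that by linarith
      then have "(2::real) ^ h < 2 ^ Suc h'" unfolding mult_less_cancel_right_pos[OF that(3)] .
      then show ?thesis by (rule power_less_imp_less_exp[rotated]) simp
    qed
    note b = F.interior_coord_bounds[OF n \<iota> x q False]
      F'.interior_coord_bounds[OF n \<iota> x' q, folded rp[OF q], OF False]
    show ?thesis using *[OF b(1) b(5) b(3)] *[OF b(4) b(2) b(3)] by simp
  qed
  have nc: "node_coord n \<iota> F x (nfs_order n F ! q) = node_coord n \<iota> F' x (nfs_order n F' ! q)"
    if "q \<le> n" for q
    using that by (simp add: F.node_coord_order F'.node_coord_order rp ht)
  have "nfs_order n F ! q = nfs_order n F' ! q" if q: "q \<le> n" for q
  proof -
    have "{p \<in> {..n}. \<not> node_coord n \<iota> F x (nfs_order n F ! q) < node_coord n \<iota> F x (nfs_order n F ! p)}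
      = {p \<in> {..n}. \<not> node_coord n \<iota> F' x (nfs_order n F' ! q) < node_coord n \<iota> F' x (nfs_order n F' ! p)}"
      using nc q by auto
    then show ?thesis
      using F.interior_label[OF n \<iota> x q] F'.interior_label[OF n \<iota> x' q] by metis
  qed
  then have order: "nfs_order n F = nfs_order n F'"
    using F.order_facts(3) F'.order_facts(3) by (intro nth_equalityI) auto
  have roots: "comp_root F (nfs_order n F ! q) = nfs_order n F ! q
      \<longleftrightarrow> comp_root F' (nfs_order n F ! q) = nfs_order n F ! q" if "q \<le> n" for q
    using that rp F.root_pos_eq_iff[OF that] F'.root_pos_eq_iff[OF that] order by simp
  show ?thesis
  proof
    show "F \<subseteq> F'" using forest_subset[OF F F' order] ht roots order by simp
    show "F' \<subseteq> F" using forest_subset[OF F' F order[symmetric]] ht roots order by simp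
  qed
qed

section \<open>The triangulation\<close>

lemma finite_labeled_graphs: "finite (labeled_graphs n)"
  and card_labeled_graphs: "card (labeled_graphs n) = 2 ^ ((n+1) choose 2)"
proof -
  have "labeled_graphs n = Pow {e. e \<subseteq> {1..n+1} \<and> card e = 2}"
    by (auto simp: labeled_graphs_def)
  moreover have "finite {e. e \<subseteq> {1..n+1} \<and> card e = 2}" by simp
  moreover have "card {e. e \<subseteq> {1..n+1} \<and> card e = 2} = (n+1) choose 2"
    using n_subsets[of "{1..n+1}" 2] by simp
  ultimately show "finite (labeled_graphs n)" "card (labeled_graphs n) = 2 ^ ((n+1) choose 2)"
    by (simp_all add: card_Pow)
qed

lemma finite_labeled_forests: "finite (labeled_forests n)"
  by (rule finite_subset[OF _ finite_labeled_graphs[of n]]) (auto simp: labeled_forests_def)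

lemma nfs_forest_in_forests: "G \<in> labeled_graphs n \<Longrightarrow> \<Phi> n G \<in> labeled_forests n"
  using labeled_graph.forest_edges_forest labeled_graph.nfs_forest_eq
  by (metis labeled_graph.intro)

lemma sum_card_fibers:
  "(\<Sum>F\<in>labeled_forests n. card {G \<in> labeled_graphs n. \<Phi> n G = F}) = 2 ^ ((n+1) choose 2)"
  using sum.group[of "labeled_graphs n" "labeled_forests n" "\<Phi> n" "\<lambda>_. 1 :: nat"]
    finite_labeled_graphs finite_labeled_forests nfs_forest_in_forests
  by (auto simp: card_labeled_graphs)

section \<open>The Gayley polytope as an order simplex\<close>

lemma gayley_polytope_facts:
  fixes \<iota> :: "nat \<Rightarrow> 'n::finite"
  assumes n: "n \<ge> 1" and \<iota>: "bij_betw \<iota> {1..n} UNIV"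
  shows "int n simplex gayley_polytope n \<iota>"
    and "fact n * measure lebesgue (gayley_polytope n \<iota>) = 2 ^ ((n+1) choose 2)"
    and "interior (gayley_polytope n \<iota>) \<noteq> {}"
proof -
  define T where "T x = (\<chi> j. x $ j / 2 ^ inv_into {1..n} \<iota> j)" for x :: "real ^ 'n"
  \<comment> \<open>The quotients by powers of 2 decrease with the index, so the increasing chain
    runs through the indices from \<open>n\<close> down to 1.\<close>
  define p where "p k = n + 1 - k" for k
  define c where "c k x = (if k = 0 then 0 else x $ \<iota> (p k) / 2 ^ p k)" for k and x :: "real ^ 'n"
  have T: "T x $ \<iota> i = x $ \<iota> i / 2 ^ i" if "i \<in> {1..n}" for x i
    using \<iota> that by (simp add: T_def bij_betw_def)
  have tri: "triangular n \<iota> (\<lambda>i. 1 / 2 ^ i) (\<lambda>_ _. 0) T"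
    using \<iota> T by (auto simp: triangular_def module_hom_zero)
  have p: "bij_betw p {1..n} {1..n}"
    by (rule bij_betw_byWitness[where f' = p]) (auto simp: p_def)
  have eq: "gayley_polytope n \<iota> = {x. (\<forall>k\<in>{1..n}. c (k-1) x \<le> c k x) \<and> c n x \<le> 1}"
  proof (intro set_eqI iffI)
    fix x assume "x \<in> gayley_polytope n \<iota>"
    then have x: "0 \<le> coord \<iota> x i" "coord \<iota> x i \<le> 2 * coord \<iota> x (i-1)" if "i \<in> {1..n}" for i
      using that unfolding gayley_polytope_eq[OF n] by auto
    have "c (k-1) x \<le> c k x" if k: "k \<in> {1..n}" for k
    proof (cases "k = 1")
      case True
      then show ?thesis using x(1)[of n] n by (simp add: c_def p_def coord_def)
    next
      case False
      then have "p (k-1) = Suc (p k)" "Suc (p k) \<in> {1..n}" "p k \<noteq> 0" using k by (auto simp: p_def)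
      then show ?thesis using x(2)[of "Suc (p k)"] False k by (simp add: c_def coord_def field_simps)
    qed
    moreover have "c n x \<le> 1" using x(2)[of 1] n by (simp add: c_def p_def coord_def)
    ultimately show "x \<in> {x. (\<forall>k\<in>{1..n}. c (k-1) x \<le> c k x) \<and> c n x \<le> 1}" by blast
  next
    fix x assume "x \<in> {x. (\<forall>k\<in>{1..n}. c (k-1) x \<le> c k x) \<and> c n x \<le> 1}"
    then have x: "\<And>k. k \<in> {1..n} \<Longrightarrow> c (k-1) x \<le> c k x" "c n x \<le> 1" by auto
    \<comment> \<open>Only the sign of the last coordinate is an inequality of the chain; the other
      signs follow along it.\<close>
    have nonneg: "k \<le> n \<Longrightarrow> 0 \<le> c k x" for k
    proof (induction k)
      case (Suc k)
      then show ?case using x(1)[of "Suc k"] by simp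
    qed (simp add: c_def)
    have "0 \<le> coord \<iota> x i \<and> coord \<iota> x i \<le> 2 * coord \<iota> x (i-1)" if i: "i \<in> {1..n}" for i
    proof
      have pp: "p (p i) = i" "p i \<noteq> 0" "p i \<le> n" using i by (auto simp: p_def)
      then show "0 \<le> coord \<iota> x i" using nonneg[of "p i"] i by (simp add: c_def coord_def field_simps)
      show "coord \<iota> x i \<le> 2 * coord \<iota> x (i-1)"
      proof (cases "i = 1")
        case True
        then show ?thesis using x(2) n by (simp add: c_def p_def coord_def)
      next
        case False
        then have "p (Suc (p i)) = i - 1" "Suc (p i) \<in> {1..n}" using i by (auto simp: p_def)
        then have "x $ \<iota> i / 2 ^ i \<le> x $ \<iota> (i - 1) / 2 ^ (i - 1)"
          using x(1)[of "Suc (p i)"] pp by (simp add: c_def)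
        moreover have "(2::real) ^ i = 2 * 2 ^ (i - 1)" using i by (cases i) auto
        ultimately show ?thesis using i False by (simp add: coord_def field_simps)
      qed
    qed
    then show "x \<in> gayley_polytope n \<iota>" unfolding gayley_polytope_eq[OF n] by blast
  qed
  have c: "c k x = T x $ \<iota> (p k)" if "k \<in> {1..n}" for k x
  proof -
    have "p k \<in> {1..n}" using that by (auto simp: p_def)
    then show ?thesis using T that by (simp add: c_def)
  qed
  note chain = chain_simplex[OF tri p, of c, OF _ c, folded eq]
  show "int n simplex gayley_polytope n \<iota>" "interior (gayley_polytope n \<iota>) \<noteq> {}"
    using chain by (auto simp: c_def)
  \<comment> \<open>The exponents on the diagonal add up to the number of possible edges.\<close>
  have "(\<Sum>i=1..n. i) = (n+1) choose 2"
    by (induction n) (simp_all add: numeral_2_eq_2)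
  then have "(\<Prod>i=1..n. 1 / 2 ^ i) = (1 / 2 ^ ((n+1) choose 2) :: real)"
    by (simp only: prod_dividef power_sum[symmetric] prod.neutral_const)
  moreover have "fact n * (\<Prod>i=1..n. 1 / 2 ^ i) * measure lebesgue (gayley_polytope n \<iota>) = 1"
    using chain(2) by (simp add: c_def)
  ultimately have "fact n * (1 / 2 ^ ((n+1) choose 2)) * measure lebesgue (gayley_polytope n \<iota>) = 1"
    by (simp only:)
  then show "fact n * measure lebesgue (gayley_polytope n \<iota>) = 2 ^ ((n+1) choose 2)"
    by (simp add: field_simps)
qed

text \<open>The difference is a null set, so the open set \<open>interior P - U\<close> is empty;
  \<open>P\<close> lies in the closure of its interior and hence in the closed set
  \<open>U\<close>.\<close>

lemma convex_eq_closed_subset: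
  fixes P U :: "'a::euclidean_space set"
  assumes "convex P" "closed P" "P \<in> lmeasurable" "interior P \<noteq> {}"
    and U: "closed U" "U \<subseteq> P" "measure lebesgue U = measure lebesgue P"
  shows "U = P"
proof -
  have "U \<in> sets lebesgue" using U(1) by (simp add: borel_closed)
  then have "measure lebesgue (P - U) = 0"
    using U assms(3) by (subst measurable_measure_Diff) auto
  moreover have "P - U \<in> lmeasurable" using assms(3) \<open>U \<in> sets lebesgue\<close> by (rule fmeasurable_Diff)
  ultimately have "negligible (P - U)" by (simp add: negligible_iff_measure0)
  then have "negligible (interior P - U)" by (rule negligible_subset) (use interior_subset in blast)
  moreover have "open (interior P - U)" using U(1) by (intro open_Diff) auto
  ultimately have "interior P \<subseteq> U" using open_not_negligible by blast
  then have "closure (interior P) \<subseteq> U" using U(1) by (rule closure_minimal)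
  then have "P \<subseteq> U"
    using convex_closure_interior[OF assms(1,4)] closure_subset by blast
  then show ?thesis using U(2) by blast
qed

text \<open>\<open>triangulates\<close> speaks of the set of simplices; \<open>inj_on\<close> adds
  that different forests give different members, so the interiors are disjoint for the family
  indexed by forests.\<close>

theorem theorem5p1:
  fixes n :: nat and \<iota> :: "nat \<Rightarrow> 'n::finite"
  assumes "n \<ge> 1" and "CARD('n) = n" and "bij_betw \<iota> {1..n} UNIV"
  shows "(\<forall>F\<in>labeled_forests n.
            int n simplex forest_simplex n \<iota> F \<and>
            fact n * measure lebesgue (forest_simplex n \<iota> F)
              = real (card {G \<in> labeled_graphs n. \<Phi> n G = F}) \<and>
            card {G \<in> labeled_graphs n. \<Phi> n G = F} = 2 ^ \<alpha> F)
       \<and> inj_on (forest_simplex n \<iota>) (labeled_forests n)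
       \<and> triangulates (forest_simplex n \<iota> ` labeled_forests n) (gayley_polytope n \<iota>)
       \<and> fact n * measure lebesgue (gayley_polytope n \<iota>) = 2 ^ ((n+1) choose 2)"
proof (intro conjI)
  let ?S = "forest_simplex n \<iota>" and ?P = "gayley_polytope n \<iota>" and ?\<F> = "labeled_forests n"
  note n = assms(1) and \<iota> = assms(3)
  have forest: "labeled_forest n F" if "F \<in> ?\<F>" for F using that labeled_forest_iff by blast
  note facts = labeled_forest.forest_simplex_facts[OF forest n \<iota>]
  have fiber: "card {G \<in> labeled_graphs n. \<Phi> n G = F} = 2 ^ \<alpha> F" if "F \<in> ?\<F>" for F
    by (rule labeled_forest.card_nfs_fiber[OF forest[OF that]])
  show "\<forall>F\<in>?\<F>. int n simplex ?S F \<and>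
      fact n * measure lebesgue (?S F) = real (card {G \<in> labeled_graphs n. \<Phi> n G = F}) \<and>
      card {G \<in> labeled_graphs n. \<Phi> n G = F} = 2 ^ \<alpha> F"
    using facts(1,2) fiber by simp
  have unique: "F = F'" if "F \<in> ?\<F>" "F' \<in> ?\<F>" "x \<in> interior (?S F)" "x \<in> interior (?S F')" for F F' x
    using interior_forest_unique[OF n \<iota> forest forest] that by blast
  show "inj_on ?S ?\<F>"
  proof (rule inj_onI)
    fix F F' assume F: "F \<in> ?\<F>" "F' \<in> ?\<F>" "?S F = ?S F'"
    obtain x where "x \<in> interior (?S F)" using facts(3)[OF F(1)] by blast
    then show "F = F'" using unique[of F F' x] F by simp
  qed
  show "fact n * measure lebesgue ?P = 2 ^ ((n+1) choose 2)" by (rule gayley_polytope_facts(2)[OF n \<iota>])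
  \<comment> \<open>Distinct simplices share no interior point, so a common point lies on a
    frontier, and frontiers of convex sets are null sets.\<close>
  have overlap: "negligible (?S F \<inter> ?S F')" if F: "F \<in> ?\<F>" "F' \<in> ?\<F>" "F \<noteq> F'" for F F'
  proof (rule negligible_subset)
    show "negligible (frontier (?S F) \<union> frontier (?S F'))"
      using facts(1) F by (intro negligible_Un negligible_convex_frontier) (auto intro: convex_simplex)
    show "?S F \<inter> ?S F' \<subseteq> frontier (?S F) \<union> frontier (?S F')"
      using unique[OF F(1,2)] F(3) closure_subset unfolding frontier_def by blast
  qed
  have meas: "?S F \<in> lmeasurable" if "F \<in> ?\<F>" for F
    using facts(1)[OF that] by (intro lmeasurable_compact compact_simplex)
  \<comment> \<open>The normalized volumes are the sizes of the fibers of \<open>\<Phi>\<close>, and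
    each graph lies in exactly one fiber, so they add up to the number of all graphs.\<close>
  have "fact n * measure lebesgue (\<Union>F\<in>?\<F>. ?S F) = (\<Sum>F\<in>?\<F>. fact n * measure lebesgue (?S F))"
    using overlap meas finite_labeled_forests
    by (subst measure_negligible_finite_Union_image) (auto simp: pairwise_def sum_distrib_left)
  also have "\<dots> = (\<Sum>F\<in>?\<F>. real (card {G \<in> labeled_graphs n. \<Phi> n G = F}))"
    using facts(2) fiber by (intro sum.cong) auto
  also have "\<dots> = real (2 ^ ((n+1) choose 2))"
    unfolding sum_card_fibers[symmetric] by simp
  also have "\<dots> = fact n * measure lebesgue ?P" using gayley_polytope_facts(2)[OF n \<iota>] by simp
  finally have vol: "measure lebesgue (\<Union>F\<in>?\<F>. ?S F) = measure lebesgue ?P" by simp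
  note P = gayley_polytope_facts(1,3)[OF n \<iota>]
  have "(\<Union>F\<in>?\<F>. ?S F) = ?P"
  proof (rule convex_eq_closed_subset)
    show "convex ?P" "closed ?P" "?P \<in> lmeasurable" "interior ?P \<noteq> {}"
      using P by (auto intro: convex_simplex closed_simplex lmeasurable_compact compact_simplex)
    show "closed (\<Union>F\<in>?\<F>. ?S F)"
      using finite_labeled_forests facts(1) by (intro closed_UN) (auto intro: closed_simplex)
    show "(\<Union>F\<in>?\<F>. ?S F) \<subseteq> ?P"
      using labeled_forest.forest_simplex_subset[OF forest n] by blast
  qed (rule vol)
  moreover have "pairwise (\<lambda>S T. interior S \<inter> interior T = {}) (?S ` ?\<F>)"
    using unique by (intro pairwiseI) blast
  moreover have "polytope ?P" using P(1) by (rule simplex_imp_polytope)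
  ultimately show "triangulates (?S ` ?\<F>) ?P"
    unfolding triangulates_def using facts(1) assms(2) by simp
qed

end
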